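(* $\mathrm{Ba}(C_p(\beta\omega))\neq\mathrm{Ba}(C_w(\beta\omega))$.
   Context: For a compact space $K$, $C_p(K)$ (resp. $C_w(K)$) denotes the Banach space $C(K)$ of continuous real-valued functions on $K$ equipped with the topology of pointwise convergence (resp. the weak topology), and $\mathrm{Ba}(\cdot)$ denotes the Baire $\sigma$-algebra of a topological space (the smallest $\sigma$-algebra making all continuous real-valued functions measurable). $\beta\omega$ is the Čech–Stone compactification of the discrete space $\omega$. *)

theory Defs
  imports "HOL-Analysis.Analysis"
begin

definition baire_sets :: "'a topology \<Rightarrow> 'a set set" where
  "baire_sets T = sigma_sets (topspace T)
     {f -` U \<inter> topspace T | f U. continuous_map T euclideanreal f \<and> open U}"

text \<open>Elements of C(K): continuous real functions on the carrier of K,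
  normalised to be 0 off the carrier (so that they are uniquely represented
  and form a real vector space under pointwise operations).\<close>
definition Cfun :: "'a topology \<Rightarrow> ('a \<Rightarrow> real) set" where
  "Cfun K = {f. continuous_map K euclideanreal f \<and> (\<forall>x. x \<notin> topspace K \<longrightarrow> f x = 0)}"

definition supnorm :: "'a topology \<Rightarrow> ('a \<Rightarrow> real) \<Rightarrow> real" where
  "supnorm K f = (SUP x\<in>topspace K. \<bar>f x\<bar>)"

definition dual_C :: "'a topology \<Rightarrow> (('a \<Rightarrow> real) \<Rightarrow> real) set" where
  "dual_C K = {\<phi>. (\<forall>f\<in>Cfun K. \<forall>g\<in>Cfun K. \<phi> (\<lambda>x. f x + g x) = \<phi> f + \<phi> g)
                 \<and> (\<forall>f\<in>Cfun K. \<forall>c::real. \<phi> (\<lambda>x. c * f x) = c * \<phi> f)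
                 \<and> (\<exists>M. \<forall>f\<in>Cfun K. \<bar>\<phi> f\<bar> \<le> M * supnorm K f)}"

definition Cp :: "'a topology \<Rightarrow> ('a \<Rightarrow> real) topology" where
  "Cp K = topology_generated_by
     (insert (Cfun K) {{f \<in> Cfun K. f x \<in> U} | x U. x \<in> topspace K \<and> open U})"

definition Cw :: "'a topology \<Rightarrow> ('a \<Rightarrow> real) topology" where
  "Cw K = topology_generated_by
     (insert (Cfun K) {{f \<in> Cfun K. \<phi> f \<in> U} | \<phi> U. \<phi> \<in> dual_C K \<and> open U})"

text \<open>Standard model: the space of ultrafilters on \<omega> = nat with the Stone
  topology, whose basic open sets are {p. A \<in> p} for A \<subseteq> nat.\<close>
definition ultrafilter_on_nat :: "nat set set \<Rightarrow> bool" where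
  "ultrafilter_on_nat p \<longleftrightarrow>
     UNIV \<in> p \<and> {} \<notin> p \<and>
     (\<forall>A B. A \<in> p \<and> A \<subseteq> B \<longrightarrow> B \<in> p) \<and>
     (\<forall>A B. A \<in> p \<and> B \<in> p \<longrightarrow> A \<inter> B \<in> p) \<and>
     (\<forall>A. A \<in> p \<or> - A \<in> p)"

definition beta_omega :: "nat set set topology" where
  "beta_omega = topology_generated_by
     {{p. ultrafilter_on_nat p \<and> A \<in> p} | A. True}"

end

theory Submission
  imports Defs
begin

text \<open>
  Restrict everything to the characteristic functions \<open>\<chi>\<^sub>A\<close> of clopen sets, that is, to
  subsets \<open>A\<close> of \<open>\<omega>\<close>. These form a dense subset of a Cantor cube indexed by the ultrafilters,
  so by the countable chain condition a continuous function on \<open>C\<^sub>p\<close> depends, on them, on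
  countably many ultrafilters only, and hence so does every Baire set \<open>S\<close>. If \<open>E\<close> belongs to all the
  nonprincipal ones among these, then membership of \<open>E \<union> X\<close> in \<open>S\<close> is a Borel condition on \<open>X\<close>,
  so it has the Baire property.

  Take for the functional an ultralimit \<open>\<mu>\<close> of means over disjoint finite products
  \<open>J\<^sub>k\<close> of \<open>k\<close> factors of sizes \<open>c\<^sub>0, ..., c\<^sub>k\<^sub>-\<^sub>1\<close>. An ultrafilter \<open>U\<^sub>n\<close> picks a
  value \<open>f n\<close> of the \<open>n\<close>-th coordinate, and the set \<open>E\<close> of sequences that hit \<open>f n\<close> at some
  coordinate \<open>n\<close> belongs to all \<open>U\<^sub>n\<close>, while \<open>\<mu> E = 1/2\<close>. So \<open>X \<mapsto> \<mu> (E \<union> X) - \<mu> E\<close> would be a nonzero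
  finitely additive measure on \<open>\<omega>\<close> that vanishes on finite sets and has the Baire property.
  This is absurd: a comeagre subset of the power set of \<open>\<omega>\<close> contains three almost disjoint sets, and
  also two sets whose union is cofinite.
\<close>

section \<open>Baire category on the power set of the natural numbers\<close>

definition agree_below :: "nat \<Rightarrow> nat set \<Rightarrow> nat set \<Rightarrow> bool" where
  "agree_below n A B \<longleftrightarrow> (\<forall>i<n. i \<in> A \<longleftrightarrow> i \<in> B)"

text \<open>The sets \<open>{X. agree_below n A X}\<close> are the cylinders, the basic clopen sets
  of the Cantor space. The condition puts a cylinder contained in \<open>D\<close> inside every
  cylinder, so \<open>D\<close> contains a dense open set.\<close>

definition dense_interior :: "nat set set \<Rightarrow> bool" where
  "dense_interior D \<longleftrightarrow>
     (\<forall>A n. \<exists>B m. n \<le> m \<and> agree_below n A B \<and> (\<forall>X. agree_below m B X \<longrightarrow> X \<in> D))"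

text \<open>Being open modulo a meagre set, in forcing form: below every cylinder some cylinder
  decides \<open>S\<close> on \<open>\<Inter>\<D>\<close>. For a countable \<open>\<D>\<close> of
  sets with dense interior this intersection is comeagre.\<close>

definition baire_property_wrt :: "nat set set set \<Rightarrow> nat set set \<Rightarrow> bool" where
  "baire_property_wrt \<D> S \<longleftrightarrow>
     (\<forall>A n. \<exists>B m. n \<le> m \<and> agree_below n A B \<and>
        ((\<forall>X. agree_below m B X \<longrightarrow> X \<in> \<Inter>\<D> \<longrightarrow> X \<in> S) \<or>
         (\<forall>X. agree_below m B X \<longrightarrow> X \<in> \<Inter>\<D> \<longrightarrow> X \<notin> S)))"

definition baire_property :: "nat set set \<Rightarrow> bool" where
  "baire_property S \<longleftrightarrow>
     (\<exists>\<D>. countable \<D> \<and> (\<forall>D\<in>\<D>. dense_interior D) \<and> baire_property_wrt \<D> S)"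

lemma agree_below_refl [simp]: "agree_below n A A"
  by (simp add: agree_below_def)

lemma agree_below_trans:
  "agree_below n A B \<Longrightarrow> agree_below m B C \<Longrightarrow> n \<le> m \<Longrightarrow> agree_below n A C"
  by (simp add: agree_below_def)

lemma agree_below_mono: "agree_below m A B \<Longrightarrow> n \<le> m \<Longrightarrow> agree_below n A B"
  by (simp add: agree_below_def)

lemma baire_property_wrt_Compl:
  "baire_property_wrt \<D> S \<Longrightarrow> baire_property_wrt \<D> (- S)"
  unfolding baire_property_wrt_def by (simp add: disj_commute)

lemma baire_property_Compl: "baire_property S \<Longrightarrow> baire_property (- S)"
  unfolding baire_property_def using baire_property_wrt_Compl by blast

lemma baire_property_const: "baire_property {X. P}"
  unfolding baire_property_def baire_property_wrt_def
  by (rule exI[of _ "{}"]) (auto intro: agree_below_refl)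

lemma baire_property_mem: "baire_property {X. i \<in> X}"
proof -
  have "baire_property_wrt {} {X. i \<in> X}"
    unfolding baire_property_wrt_def
  proof (intro allI)
    fix A n
    show "\<exists>B m. n \<le> m \<and> agree_below n A B \<and>
      ((\<forall>X. agree_below m B X \<longrightarrow> X \<in> \<Inter>{} \<longrightarrow> X \<in> {X. i \<in> X}) \<or>
       (\<forall>X. agree_below m B X \<longrightarrow> X \<in> \<Inter>{} \<longrightarrow> X \<notin> {X. i \<in> X}))"
      by (intro exI[of _ A] exI[of _ "max n (Suc i)"]) (auto simp: agree_below_def)
  qed
  then show ?thesis
    unfolding baire_property_def by (intro exI[of _ "{}"]) simp
qed

lemma dense_interior_UNIV: "dense_interior UNIV"
  unfolding dense_interior_def using agree_below_refl by blast

text \<open>If \<open>X\<close> lies in a deciding cylinder of length \<open>m\<close>, then that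
  cylinder is also the one of length \<open>m\<close> around \<open>X\<close>. Putting this set into
  the family gives every generic \<open>X\<close> a neighbourhood that decides
  \<open>S\<close>.\<close>

lemma dense_interior_decided:
  assumes "baire_property_wrt \<D> S"
  shows "dense_interior {X. \<exists>m. (\<forall>Y. agree_below m X Y \<longrightarrow> Y \<in> \<Inter>\<D> \<longrightarrow> Y \<in> S) \<or>
                               (\<forall>Y. agree_below m X Y \<longrightarrow> Y \<in> \<Inter>\<D> \<longrightarrow> Y \<notin> S)}"
  unfolding dense_interior_def
proof (intro allI)
  fix A n
  obtain B m where B: "n \<le> m" "agree_below n A B"
      "(\<forall>X. agree_below m B X \<longrightarrow> X \<in> \<Inter>\<D> \<longrightarrow> X \<in> S) \<or>
       (\<forall>X. agree_below m B X \<longrightarrow> X \<in> \<Inter>\<D> \<longrightarrow> X \<notin> S)"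
    using assms unfolding baire_property_wrt_def by blast
  have "X \<in> {X. \<exists>m. (\<forall>Y. agree_below m X Y \<longrightarrow> Y \<in> \<Inter>\<D> \<longrightarrow> Y \<in> S) \<or>
                               (\<forall>Y. agree_below m X Y \<longrightarrow> Y \<in> \<Inter>\<D> \<longrightarrow> Y \<notin> S)}"
    if "agree_below m B X" for X
    using B(3) agree_below_trans[OF that _ order_refl] by blast
  with B(1,2) show "\<exists>B m. n \<le> m \<and> agree_below n A B \<and> (\<forall>X. agree_below m B X \<longrightarrow>
      X \<in> {X. \<exists>m. (\<forall>Y. agree_below m X Y \<longrightarrow> Y \<in> \<Inter>\<D> \<longrightarrow> Y \<in> S) \<or>
                               (\<forall>Y. agree_below m X Y \<longrightarrow> Y \<in> \<Inter>\<D> \<longrightarrow> Y \<notin> S)})"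
    by blast
qed

text \<open>Either some \<open>S i\<close> is forced to hold on a cylinder inside the given one, or
  every generic \<open>X\<close> there avoids all \<open>S i\<close>: the cylinder around
  \<open>X\<close> that decides \<open>S i\<close> cannot decide it positively.\<close>

lemma baire_property_UN:
  fixes S :: "nat \<Rightarrow> nat set set"
  assumes "\<And>i. baire_property (S i)"
  shows "baire_property (\<Union>i. S i)"
proof -
  obtain \<D> where \<D>: "\<And>i. countable (\<D> i)" "\<And>i D. D \<in> \<D> i \<Longrightarrow> dense_interior D"
      "\<And>i. baire_property_wrt (\<D> i) (S i)"
    using assms unfolding baire_property_def by metis
  define E where "E i = {X. \<exists>m. (\<forall>Y. agree_below m X Y \<longrightarrow> Y \<in> \<Inter>(\<D> i) \<longrightarrow> Y \<in> S i) \<or>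
                               (\<forall>Y. agree_below m X Y \<longrightarrow> Y \<in> \<Inter>(\<D> i) \<longrightarrow> Y \<notin> S i)}" for i
  define \<E> where "\<E> = (\<Union>i. \<D> i) \<union> range E"
  have E: "dense_interior (E i)" for i
    unfolding E_def by (rule dense_interior_decided[OF \<D>(3)])
  have sub: "X \<in> \<Inter>(\<D> i)" "X \<in> E i" if "X \<in> \<Inter>\<E>" for X i
    using that unfolding \<E>_def by blast+
  have "baire_property_wrt \<E> (\<Union>i. S i)"
    unfolding baire_property_wrt_def
  proof (intro allI)
    fix A n
    show "\<exists>B m. n \<le> m \<and> agree_below n A B \<and>
      ((\<forall>X. agree_below m B X \<longrightarrow> X \<in> \<Inter>\<E> \<longrightarrow> X \<in> (\<Union>i. S i)) \<or>
       (\<forall>X. agree_below m B X \<longrightarrow> X \<in> \<Inter>\<E> \<longrightarrow> X \<notin> (\<Union>i. S i)))"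
    proof (cases "\<exists>i B m. n \<le> m \<and> agree_below n A B \<and>
          (\<forall>X. agree_below m B X \<longrightarrow> X \<in> \<Inter>(\<D> i) \<longrightarrow> X \<in> S i)")
      case True
      then obtain i B m where B: "n \<le> m" "agree_below n A B"
          "\<And>X. agree_below m B X \<Longrightarrow> X \<in> \<Inter>(\<D> i) \<Longrightarrow> X \<in> S i"
        by blast
      have "\<forall>X. agree_below m B X \<longrightarrow> X \<in> \<Inter>\<E> \<longrightarrow> X \<in> (\<Union>i. S i)"
        using B(3) sub(1) by blast
      with B(1,2) show ?thesis by blast
    next
      case False
      have "X \<notin> S i" if X: "agree_below n A X" "X \<in> \<Inter>\<E>" for X i
      proof -
        obtain m where m: "(\<forall>Y. agree_below m X Y \<longrightarrow> Y \<in> \<Inter>(\<D> i) \<longrightarrow> Y \<in> S i) \<or>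
                           (\<forall>Y. agree_below m X Y \<longrightarrow> Y \<in> \<Inter>(\<D> i) \<longrightarrow> Y \<notin> S i)"
          using sub(2)[OF X(2), of i] unfolding E_def by blast
        from m show ?thesis
        proof
          assume pos: "\<forall>Y. agree_below m X Y \<longrightarrow> Y \<in> \<Inter>(\<D> i) \<longrightarrow> Y \<in> S i"
          \<comment> \<open>Lengthening the cylinder to at least \<open>n\<close> places it inside
            the given one, where the case assumption excludes it.\<close>
          have "\<forall>Y. agree_below (max m n) X Y \<longrightarrow> Y \<in> \<Inter>(\<D> i) \<longrightarrow> Y \<in> S i"
            using pos agree_below_mono[of "max m n" X _ m] by fastforce
          then have False
            using False X(1) max.cobounded2 by blast
          then show ?thesis ..
        next
          assume "\<forall>Y. agree_below m X Y \<longrightarrow> Y \<in> \<Inter>(\<D> i) \<longrightarrow> Y \<notin> S i"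
          then show ?thesis
            using sub(1)[OF X(2)] agree_below_refl by blast
        qed
      qed
      then show ?thesis
        using agree_below_refl order_refl by blast
    qed
  qed
  moreover have "countable \<E>"
    unfolding \<E>_def using \<D>(1) by simp
  moreover have "\<forall>D\<in>\<E>. dense_interior D"
    unfolding \<E>_def using \<D>(2) E by blast
  ultimately show ?thesis
    unfolding baire_property_def by blast
qed

text \<open>With \<open>P = {}\<close> the generic sets are almost disjoint; with \<open>P = UNIV\<close> the union of any
  two of them is cofinite.\<close>

lemma generic_family:
  assumes "countable \<D>" and dense: "\<forall>D\<in>\<D>. dense_interior D"
  shows "\<exists>Z :: nat \<Rightarrow> nat set. (\<forall>i. Z i \<in> \<Inter>\<D>) \<and> (\<forall>i. agree_below n A (Z i)) \<and>
    (\<forall>k i j. n \<le> k \<longrightarrow> i \<noteq> j \<longrightarrow> (k \<in> Z i \<longleftrightarrow> k \<in> P) \<or> (k \<in> Z j \<longleftrightarrow> k \<in> P))"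
proof -
  \<comment> \<open>Adding \<open>UNIV\<close> keeps the enumeration total when \<open>\<D>\<close>
    is empty and leaves the intersection unchanged.\<close>
  define d where "d = from_nat_into (insert UNIV \<D>)"
  have d_range: "range d = insert UNIV \<D>"
    unfolding d_def using assms(1) by (intro range_from_nat_into) auto
  have d_dense: "dense_interior (d k)" for k
  proof -
    have "d k \<in> insert UNIV \<D>" using d_range by blast
    then show ?thesis
      using dense dense_interior_UNIV by auto
  qed
  \<comment> \<open>A state is a length and a sequence of sets. From the length on all sets coincide
    with \<open>P\<close>, and at each place from \<open>n\<close> on at most one set deviates from
    \<open>P\<close>. Stage \<open>k\<close> of \<open>Q\<close> treats the pair
    \<open>(i, l)\<close> decoded from \<open>k\<close> and forces set \<open>i\<close> into
    \<open>d l\<close>, changing no set below the current length.\<close>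
  define I where "I s \<longleftrightarrow> n \<le> fst s \<and> (\<forall>i. agree_below n A (snd s i)) \<and>
      (\<forall>i k. fst s \<le> k \<longrightarrow> (k \<in> snd s i \<longleftrightarrow> k \<in> P)) \<and>
      (\<forall>i j k. n \<le> k \<longrightarrow> i \<noteq> j \<longrightarrow> (k \<in> snd s i \<longleftrightarrow> k \<in> P) \<or> (k \<in> snd s j \<longleftrightarrow> k \<in> P))"
    for s :: "nat \<times> (nat \<Rightarrow> nat set)"
  define Q where "Q k s t \<longleftrightarrow> fst s < fst t \<and> (\<forall>i. agree_below (fst s) (snd s i) (snd t i)) \<and>
      (\<forall>X. agree_below (fst t) (snd t (fst (prod_decode k))) X \<longrightarrow> X \<in> d (snd (prod_decode k)))"
    for k and s t :: "nat \<times> (nat \<Rightarrow> nat set)"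
  have "\<exists>f. \<forall>k. I (f k) \<and> Q k (f k) (f (Suc k))"
  proof (rule dependent_nat_choice)
    have "I (n, \<lambda>i. {k. if k < n then k \<in> A else k \<in> P})"
      unfolding I_def by (auto simp: agree_below_def)
    then show "\<exists>s. I s" ..
  next
    fix s k assume Is: "I s"
    define m X i where "m = fst s" and "X = snd s" and "i = fst (prod_decode k)"
    obtain B m' where B: "m \<le> m'" "agree_below m (X i) B"
        "\<And>Y. agree_below m' B Y \<Longrightarrow> Y \<in> d (snd (prod_decode k))"
      using d_dense[of "snd (prod_decode k)"] unfolding dense_interior_def by blast
    \<comment> \<open>Only \<open>X i\<close> is changed, and only from \<open>m\<close> on, where
      all other sets equal \<open>P\<close>; so no second deviation arises. Resetting the tail to
      \<open>P\<close> restores the invariant.\<close>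
    define B' where "B' = {k. if k < m' then k \<in> B else k \<in> P}"
    have I: "n \<le> m" "\<And>i. agree_below n A (X i)" "\<And>i k. m \<le> k \<Longrightarrow> k \<in> X i \<longleftrightarrow> k \<in> P"
        "\<And>i j k. n \<le> k \<Longrightarrow> i \<noteq> j \<Longrightarrow> (k \<in> X i \<longleftrightarrow> k \<in> P) \<or> (k \<in> X j \<longleftrightarrow> k \<in> P)"
      using Is unfolding I_def m_def X_def by blast+
    have B'X: "agree_below m (X i) B'"
      using B(1,2) unfolding B'_def agree_below_def by auto
    \<comment> \<open>The new length is \<open>Suc m'\<close> because \<open>m'\<close> may equal
      \<open>m\<close>, and the lengths have to increase strictly.\<close>
    have "I (Suc m', X(i := B'))"
      unfolding I_def
    proof (intro conjI allI impI)
      show "n \<le> fst (Suc m', X(i := B'))" using I(1) B(1) by simp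
    next
      fix j
      show "agree_below n A (snd (Suc m', X(i := B')) j)"
        using I(2)[of j] agree_below_trans[OF I(2) B'X I(1)] by simp
    next
      fix j l assume "fst (Suc m', X(i := B')) \<le> l"
      then show "(l \<in> snd (Suc m', X(i := B')) j) = (l \<in> P)"
        using I(3)[of l j] B(1) by (auto simp: B'_def)
    next
      fix j j' l :: nat assume l: "n \<le> l" "j \<noteq> j'"
      show "(l \<in> snd (Suc m', X(i := B')) j) = (l \<in> P) \<or>
            (l \<in> snd (Suc m', X(i := B')) j') = (l \<in> P)"
      proof (cases "l < m")
        case True
        then have "l \<in> (X(i := B')) a \<longleftrightarrow> l \<in> X a" for a
          using B'X by (auto simp: agree_below_def)
        then show ?thesis using I(4)[OF l] by simp
      next
        case False
        then have "l \<in> X a \<longleftrightarrow> l \<in> P" for a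
          using I(3) by simp
        then show ?thesis using l(2) by auto
      qed
    qed
    moreover have "Q k s (Suc m', X(i := B'))"
      unfolding Q_def
    proof (intro conjI allI impI)
      show "fst s < fst (Suc m', X(i := B'))" using B(1) by (simp add: m_def)
    next
      fix j
      show "agree_below (fst s) (snd s j) (snd (Suc m', X(i := B')) j)"
        using B'X by (simp add: m_def X_def)
    next
      fix Y assume "agree_below (fst (Suc m', X(i := B'))) (snd (Suc m', X(i := B')) (fst (prod_decode k))) Y"
      then have "agree_below m' B Y"
        by (auto simp: i_def B'_def agree_below_def less_Suc_eq)
      then show "Y \<in> d (snd (prod_decode k))" by (rule B(3))
    qed
    ultimately show "\<exists>t. I t \<and> Q k s t" by blast
  qed
  then obtain f where f: "\<And>k. I (f k)" "\<And>k. Q k (f k) (f (Suc k))" by blast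
  define m X where "m k = fst (f k)" and "X k = snd (f k)" for k
  have m_less: "m k < m (Suc k)" for k
    using f(2)[of k] unfolding Q_def m_def by blast
  then have m_mono: "m k \<le> m l" if "k \<le> l" for k l
    using that by (simp add: lift_Suc_mono_le less_imp_le)
  have m_ge: "k \<le> m k" for k
    using m_less by (simp add: strict_mono_Suc_iff strict_mono_imp_increasing)
  have coh: "agree_below (m k) (X k i) (X l i)" if "k \<le> l" for k l i
    using that
  proof (induction l rule: dec_induct)
    case (step l)
    have "agree_below (m l) (X l i) (X (Suc l) i)"
      using f(2)[of l] unfolding Q_def m_def X_def by blast
    then show ?case using step.IH m_mono[OF step.hyps(1)] agree_below_trans by blast
  qed simp
  \<comment> \<open>Place \<open>j\<close> is settled at stage \<open>Suc j\<close>, the length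
    there being at least \<open>Suc j\<close>.\<close>
  define Z where "Z i = {j. j \<in> X (Suc j) i}" for i
  have XZ: "agree_below (m k) (X k i) (Z i)" for k i
    unfolding agree_below_def
  proof (intro allI impI)
    fix j assume "j < m k"
    moreover have "j < m (Suc j)" using m_ge[of "Suc j"] by simp
    ultimately have "j \<in> X k i \<longleftrightarrow> j \<in> X (Suc j) i"
      using coh[of k "Suc j" i] coh[of "Suc j" k i] nat_le_linear[of k "Suc j"]
      by (auto simp: agree_below_def)
    then show "j \<in> X k i \<longleftrightarrow> j \<in> Z i" by (simp add: Z_def)
  qed
  show ?thesis
  proof (intro exI[of _ Z] conjI allI impI)
    fix i
    have "Z i \<in> d l" for l
    proof -
      define k where "k = prod_encode (i, l)"
      have "agree_below (m (Suc k)) (X (Suc k) i) (Z i)" by (rule XZ)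
      then show ?thesis
        using f(2)[of k] unfolding Q_def m_def X_def k_def by simp
    qed
    then have "Z i \<in> \<Inter>(range d)" by blast
    then show "Z i \<in> \<Inter>\<D>" unfolding d_range by simp
  next
    fix i
    have "agree_below n A (X 0 i)" "n \<le> m 0"
      using f(1)[of 0] unfolding I_def X_def m_def by blast+
    then show "agree_below n A (Z i)"
      using XZ agree_below_trans by blast
  next
    fix i j k :: nat assume k: "n \<le> k" "i \<noteq> j"
    have "(k \<in> X (Suc k) i \<longleftrightarrow> k \<in> P) \<or> (k \<in> X (Suc k) j \<longleftrightarrow> k \<in> P)"
      using f(1)[of "Suc k"] k unfolding I_def X_def by blast
    then show "(k \<in> Z i \<longleftrightarrow> k \<in> P) \<or> (k \<in> Z j \<longleftrightarrow> k \<in> P)"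
      by (simp add: Z_def)
  qed
qed

section \<open>Ultrafilters and finite conditions\<close>

lemma ultrafilter_onD:
  assumes "ultrafilter_on_nat U"
  shows "UNIV \<in> U" "{} \<notin> U" "A \<in> U \<Longrightarrow> A \<subseteq> B \<Longrightarrow> B \<in> U"
    "A \<inter> B \<in> U \<longleftrightarrow> A \<in> U \<and> B \<in> U" "- A \<in> U \<longleftrightarrow> A \<notin> U"
    "A \<union> B \<in> U \<longleftrightarrow> A \<in> U \<or> B \<in> U"
proof -
  have U: "UNIV \<in> U" "{} \<notin> U" "\<And>A B. A \<in> U \<Longrightarrow> A \<subseteq> B \<Longrightarrow> B \<in> U"
      "\<And>A B. A \<in> U \<Longrightarrow> B \<in> U \<Longrightarrow> A \<inter> B \<in> U" "\<And>A. A \<in> U \<or> - A \<in> U"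
    using assms unfolding ultrafilter_on_nat_def by blast+
  show "UNIV \<in> U" "{} \<notin> U" by fact+
  show "A \<in> U \<Longrightarrow> A \<subseteq> B \<Longrightarrow> B \<in> U" by fact
  show int: "A \<inter> B \<in> U \<longleftrightarrow> A \<in> U \<and> B \<in> U" for A B
    using U(3,4) by (meson inf_le1 inf_le2)
  show compl: "- A \<in> U \<longleftrightarrow> A \<notin> U" for A
    using U(2,5) int[of A "- A"] by auto
  show "A \<union> B \<in> U \<longleftrightarrow> A \<in> U \<or> B \<in> U"
    using int[of "- A" "- B"] compl[of A] compl[of B] compl[of "A \<union> B"]
    by (metis Compl_Un)
qed

lemma ultrafilter_on_UN:
  assumes "ultrafilter_on_nat U" "finite I"
  shows "(\<Union>i\<in>I. A i) \<in> U \<longleftrightarrow> (\<exists>i\<in>I. A i \<in> U)"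
  using assms(2) by induction (simp_all add: ultrafilter_onD[OF assms(1)])

lemma ultrafilter_on_INT:
  assumes "ultrafilter_on_nat U" "finite I"
  shows "(\<Inter>i\<in>I. A i) \<in> U \<longleftrightarrow> (\<forall>i\<in>I. A i \<in> U)"
  using assms(2) by induction (simp_all add: ultrafilter_onD[OF assms(1)])

lemma ultrafilter_on_finite:
  assumes "ultrafilter_on_nat U" "\<And>i. {i} \<notin> U" "finite A"
  shows "A \<notin> U"
  using ultrafilter_on_UN[OF assms(1,3), of "\<lambda>i. {i}"] assms(2) by simp

lemma ultrafilter_on_eqI:
  assumes "ultrafilter_on_nat U" "ultrafilter_on_nat V" "U \<subseteq> V"
  shows "U = V"
  using ultrafilter_onD(5)[OF assms(1)] ultrafilter_onD(5)[OF assms(2)] assms(3) by auto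

lemma ultrafilter_on_principal: "ultrafilter_on_nat {A. j \<in> A}"
  unfolding ultrafilter_on_nat_def by auto

lemma ultrafilter_on_principal_eq:
  assumes "ultrafilter_on_nat U" "{j} \<in> U"
  shows "U = {A. j \<in> A}"
proof -
  have "{A. j \<in> A} \<subseteq> U"
    using ultrafilter_onD(3)[OF assms] by auto
  then show ?thesis
    using ultrafilter_on_eqI[OF ultrafilter_on_principal assms(1)] by metis
qed

text \<open>The density of the set of characteristic functions in the cube over any set of ultrafilters.\<close>

lemma ultrafilter_on_interpolate:
  assumes "finite H" "\<And>U. U \<in> H \<Longrightarrow> ultrafilter_on_nat U"
  obtains B where "\<And>U. U \<in> H \<Longrightarrow> B \<in> U \<longleftrightarrow> U \<in> p"
proof -
  have "\<exists>A. A \<in> U \<and> A \<notin> V" if "U \<in> H" "V \<in> H" "U \<noteq> V" for U V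
    using ultrafilter_on_eqI[OF assms(2)[OF that(1)] assms(2)[OF that(2)]] that(3) by blast
  then obtain S where S: "\<And>U V. U \<in> H \<Longrightarrow> V \<in> H \<Longrightarrow> U \<noteq> V \<Longrightarrow> S U V \<in> U \<and> S U V \<notin> V"
    by metis
  define A where "A U = (\<Inter>V\<in>H - {U}. S U V)" for U
  have A: "A U \<in> V \<longleftrightarrow> U = V" if "U \<in> H" "V \<in> H" for U V
    unfolding A_def using ultrafilter_on_INT[OF assms(2)[OF that(2)], of "H - {U}" "S U"] S that assms(1)
    by auto
  show thesis
  proof (rule that)
    fix V assume V: "V \<in> H"
    show "(\<Union>U\<in>H \<inter> p. A U) \<in> V \<longleftrightarrow> V \<in> p"
      using ultrafilter_on_UN[OF assms(2)[OF V], of "H \<inter> p" A] assms(1) A V by auto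
  qed
qed

text \<open>A pair \<open>(H, p)\<close> with \<open>p \<subseteq> H\<close> encodes the finite partial function on ultrafilters that is
  1 on \<open>p\<close> and 0 on \<open>H - p\<close>.\<close>

definition compatible :: "'a set \<times> 'a set \<Rightarrow> 'a set \<times> 'a set \<Rightarrow> bool" where
  "compatible c d \<longleftrightarrow> snd c \<inter> fst d = snd d \<inter> fst c"

text \<open>Volume count: over the union \<open>K\<close> of the domains, a condition with
  \<open>n\<close> places has \<open>2 ^ (card K - n)\<close> extensions, and incompatible
  conditions share none. So at most \<open>2 ^ n\<close> of them fit into the
  \<open>2 ^ card K\<close> subsets of \<open>K\<close>.\<close>

lemma finite_incompatible_conditions:
  assumes "\<And>c. c \<in> M \<Longrightarrow> finite (fst c) \<and> card (fst c) = n \<and> snd c \<subseteq> fst c"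
    and "\<And>c d. c \<in> M \<Longrightarrow> d \<in> M \<Longrightarrow> compatible c d \<Longrightarrow> c = d"
  shows "finite M"
proof -
  have "card G \<le> 2 ^ n" if G: "G \<subseteq> M" "finite G" for G
  proof -
    define K where "K = (\<Union>c\<in>G. fst c)"
    define ext where "ext c = {q. q \<subseteq> K \<and> q \<inter> fst c = snd c}" for c :: "'a set \<times> 'a set"
    have c: "finite (fst c)" "card (fst c) = n" "snd c \<subseteq> fst c" "fst c \<subseteq> K" if "c \<in> G" for c
      using assms(1)[of c] G(1) that unfolding K_def by auto
    have K: "finite K" unfolding K_def using G(2) c(1) by blast
    have card_ext: "card (ext c) = 2 ^ (card K - n)" if "c \<in> G" for c
    proof -
      have "bij_betw (\<lambda>q. q \<union> snd c) (Pow (K - fst c)) (ext c)"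
        by (rule bij_betw_byWitness[where f' = "\<lambda>q. q - fst c"])
          (use c[OF that] in \<open>auto simp: ext_def\<close>)
      then have "card (ext c) = card (Pow (K - fst c))"
        by (simp add: bij_betw_same_card)
      then show ?thesis
        using c[OF that] K by (simp add: card_Pow card_Diff_subset)
    qed
    have disj: "ext c \<inter> ext d = {}" if "c \<in> G" "d \<in> G" "c \<noteq> d" for c d
    proof -
      have "snd c \<inter> fst d \<noteq> snd d \<inter> fst c"
        using assms(2)[of c d] that G(1) unfolding compatible_def by blast
      then show ?thesis unfolding ext_def by blast
    qed
    have fin: "finite (ext c)" for c
      unfolding ext_def using K by simp
    have "card G * 2 ^ (card K - n) = (\<Sum>c\<in>G. card (ext c))"
      using card_ext by simp
    also have "\<dots> = card (\<Union>c\<in>G. ext c)"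
      using card_UN_disjoint[OF G(2), of ext] fin disj by simp
    also have "\<dots> \<le> card (Pow K)"
      by (rule card_mono) (use K in \<open>auto simp: ext_def\<close>)
    also have "\<dots> = 2 ^ card K" using K by (simp add: card_Pow)
    finally have le: "card G * 2 ^ (card K - n) \<le> 2 ^ card K" .
    show ?thesis
    proof (cases "G = {}")
      case False
      then obtain c0 where "c0 \<in> G" by blast
      then have "n \<le> card K" using c[of c0] K card_mono by metis
      then have "(2::nat) ^ card K = 2 ^ n * 2 ^ (card K - n)"
        by (simp flip: power_add)
      with le show ?thesis by simp
    qed simp
  qed
  then show ?thesis using finite_if_finite_subsets_card_bdd[of M "2 ^ n"] by blast
qed

text \<open>The countable chain condition: sorting by the size of the domain leaves finitely many
  conditions of each size.\<close>

lemma countable_incompatible_conditions: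
  assumes "\<And>c. c \<in> M \<Longrightarrow> finite (fst c) \<and> snd c \<subseteq> fst c"
    and "\<And>c d. c \<in> M \<Longrightarrow> d \<in> M \<Longrightarrow> compatible c d \<Longrightarrow> c = d"
  shows "countable M"
proof -
  have "finite {c \<in> M. card (fst c) = n}" for n
    by (rule finite_incompatible_conditions[where n = n]) (use assms in auto)
  then have "countable (\<Union>n. {c \<in> M. card (fst c) = n})"
    by (intro countable_UN) (auto intro: countable_finite)
  moreover have "M = (\<Union>n. {c \<in> M. card (fst c) = n})" by blast
  ultimately show ?thesis by simp
qed

text \<open>The topology pulled back from the cube along \<open>A \<mapsto> {U. A \<in> U}\<close>,
  with principal and nonprincipal ultrafilters as coordinates. Working with sets of naturals keeps
  the combinatorics apart from the function space.\<close>

definition pointwise_open :: "nat set set \<Rightarrow> bool" where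
  "pointwise_open W \<longleftrightarrow> (\<forall>A\<in>W. \<exists>H. finite H \<and> H \<subseteq> Collect ultrafilter_on_nat \<and>
     (\<forall>B. (\<forall>U\<in>H. A \<in> U \<longleftrightarrow> B \<in> U) \<longrightarrow> B \<in> W))"

text \<open>Zorn's lemma. Maximality gives the last clause: a condition incompatible with all of
  \<open>M\<close> could be added to \<open>M\<close>.\<close>

lemma maximal_incompatible_conditions:
  obtains M where "M \<subseteq> C"
    and "\<forall>c\<in>M. \<forall>d\<in>M. compatible c d \<longrightarrow> c = d" and "\<forall>c\<in>C. \<exists>d\<in>M. compatible c d"
proof -
  define inc where "inc M \<longleftrightarrow> (\<forall>c\<in>M. \<forall>d\<in>M. compatible c d \<longrightarrow> c = d)"
    for M :: "('a set \<times> 'a set) set"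
  have "\<exists>M\<in>{M. M \<subseteq> C \<and> inc M}. \<forall>X\<in>{M. M \<subseteq> C \<and> inc M}. M \<subseteq> X \<longrightarrow> X = M"
  proof (rule subset_Zorn')
    fix \<C> assume ch: "subset.chain {M. M \<subseteq> C \<and> inc M} \<C>"
    have "c = d" if c: "c \<in> X" "X \<in> \<C>" and d: "d \<in> X'" "X' \<in> \<C>" and cd: "compatible c d" for c d X X'
    proof -
      have "X \<subseteq> X' \<or> X' \<subseteq> X"
        using ch c(2) d(2) unfolding subset_chain_def by blast
      moreover have "inc X" "inc X'"
        using ch c(2) d(2) unfolding subset_chain_def by blast+
      ultimately show ?thesis
        using c(1) d(1) cd unfolding inc_def by blast
    qed
    then have "inc (\<Union>\<C>)"
      unfolding inc_def by blast
    then show "\<Union>\<C> \<in> {M. M \<subseteq> C \<and> inc M}"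
      using ch unfolding subset_chain_def by blast
  qed
  then obtain M where "M \<in> {M. M \<subseteq> C \<and> inc M}"
      and "\<forall>X\<in>{M. M \<subseteq> C \<and> inc M}. M \<subseteq> X \<longrightarrow> X = M"
    by (rule bexE)
  then have M: "M \<subseteq> C" "inc M" "\<And>X. X \<subseteq> C \<Longrightarrow> inc X \<Longrightarrow> M \<subseteq> X \<Longrightarrow> X = M"
    by simp_all
  show thesis
  proof (rule that[OF M(1)])
    show "\<forall>c\<in>M. \<forall>d\<in>M. compatible c d \<longrightarrow> c = d"
      using M(2) unfolding inc_def .
    show "\<forall>c\<in>C. \<exists>d\<in>M. compatible c d"
    proof (intro ballI, rule ccontr)
      fix c assume c: "c \<in> C" and "\<not> (\<exists>d\<in>M. compatible c d)"
      then have neg: "\<not> compatible c d" "\<not> compatible d c" if "d \<in> M" for d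
        using that by (auto simp: compatible_def)
      have "inc (insert c M)"
        unfolding inc_def
      proof (intro ballI impI)
        fix a b assume "a \<in> insert c M" "b \<in> insert c M" "compatible a b"
        then show "a = b"
          using M(2) neg unfolding inc_def by blast
      qed
      then have "insert c M = M" using M(3)[of "insert c M"] c M(1) by blast
      then have "c \<in> M" by (metis insertI1)
      moreover have "compatible c c" by (simp add: compatible_def)
      ultimately show False using neg(1) by simp
    qed
  qed
qed

text \<open>By the countable chain condition some countable union \<open>V\<close> of basic open sets is dense in
  \<open>W\<close>; the separating set is the closure of \<open>V\<close>, which only depends on the coordinates in
  \<open>D\<close>.\<close>

lemma pointwise_open_separation:
  assumes W: "pointwise_open W" and W': "pointwise_open W'" and disj: "W \<inter> W' = {}"
  obtains D V where "countable D" "D \<subseteq> Collect ultrafilter_on_nat"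
    "W \<subseteq> {A. \<forall>H. finite H \<and> H \<subseteq> D \<longrightarrow> (\<exists>B\<in>V. \<forall>U\<in>H. A \<in> U \<longleftrightarrow> B \<in> U)}"
    "W' \<inter> {A. \<forall>H. finite H \<and> H \<subseteq> D \<longrightarrow> (\<exists>B\<in>V. \<forall>U\<in>H. A \<in> U \<longleftrightarrow> B \<in> U)} = {}"
proof -
  define basic where "basic H p = {B. \<forall>U\<in>H. B \<in> U \<longleftrightarrow> U \<in> p}" for H p :: "nat set set set"
  define C where "C = {(H, p). finite H \<and> H \<subseteq> Collect ultrafilter_on_nat \<and> p \<subseteq> H \<and> basic H p \<subseteq> W}"
  obtain M where M: "M \<subseteq> C"
      "\<forall>c\<in>M. \<forall>d\<in>M. compatible c d \<longrightarrow> c = d" "\<forall>c\<in>C. \<exists>d\<in>M. compatible c d"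
    by (rule maximal_incompatible_conditions)
  have cM: "finite H" "H \<subseteq> Collect ultrafilter_on_nat" "p \<subseteq> H" "basic H p \<subseteq> W" if "(H, p) \<in> M" for H p
    using M(1) that unfolding C_def by auto
  have fin: "finite (fst c)" "snd c \<subseteq> fst c" and ultra: "fst c \<subseteq> Collect ultrafilter_on_nat" if "c \<in> M" for c
    using cM[of "fst c" "snd c"] that by simp_all
  have "countable M"
    by (rule countable_incompatible_conditions) (simp_all add: fin M(2))
  define D where "D = (\<Union>c\<in>M. fst c)"
  define V where "V = (\<Union>(H, p)\<in>M. basic H p)"
  have fst_D: "H \<subseteq> D" if "(H, p) \<in> M" for H p
    using UN_upper[OF that, of fst] unfolding D_def by simp
  show thesis
  proof (rule that)
    show "countable D"
      unfolding D_def by (rule countable_UN[OF \<open>countable M\<close>], rule countable_finite, rule fin(1))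
    show D: "D \<subseteq> Collect ultrafilter_on_nat"
      unfolding D_def using ultra by (rule UN_least)
    show "W \<subseteq> {A. \<forall>H. finite H \<and> H \<subseteq> D \<longrightarrow> (\<exists>B\<in>V. \<forall>U\<in>H. A \<in> U \<longleftrightarrow> B \<in> U)}"
    proof (safe)
      fix A H assume A: "A \<in> W" and H: "finite H" "H \<subseteq> D"
      obtain H0 where H0: "finite H0" "H0 \<subseteq> Collect ultrafilter_on_nat"
          "\<And>B. (\<forall>U\<in>H0. A \<in> U \<longleftrightarrow> B \<in> U) \<Longrightarrow> B \<in> W"
        using W A unfolding pointwise_open_def by meson
      \<comment> \<open>The condition \<open>(H \<union> H0, c)\<close> records \<open>A\<close> on
        these coordinates, and its cylinder lies in \<open>W\<close> because of \<open>H0\<close>.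
        It has a common extension \<open>B\<close> with a compatible member of \<open>M\<close>;
        this \<open>B\<close> lies in \<open>V\<close> and agrees with \<open>A\<close> on
        \<open>H\<close>.\<close>
      define c where "c = {U \<in> H \<union> H0. A \<in> U}"
      have "(H \<union> H0, c) \<in> C"
        unfolding C_def basic_def c_def using H H0 D by auto
      have "c \<subseteq> H \<union> H0" unfolding c_def by blast
      from \<open>(H \<union> H0, c) \<in> C\<close> obtain H1 p1 where 1: "(H1, p1) \<in> M" "c \<inter> H1 = p1 \<inter> (H \<union> H0)"
        using M(3) unfolding compatible_def by (metis fst_conv snd_conv surj_pair)
      obtain B where B: "\<And>U. U \<in> H \<union> H0 \<union> H1 \<Longrightarrow> B \<in> U \<longleftrightarrow> U \<in> c \<union> p1"
        by (rule ultrafilter_on_interpolate[of "H \<union> H0 \<union> H1" "c \<union> p1"]) (use H H0 cM[OF 1(1)] D in auto)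
      have "B \<in> U \<longleftrightarrow> U \<in> p1" if "U \<in> H1" for U
        using B[of U] 1(2) that \<open>c \<subseteq> H \<union> H0\<close> by blast
      then have "B \<in> basic H1 p1"
        unfolding basic_def by simp
      then have "B \<in> V" unfolding V_def using 1(1) by blast
      moreover have "A \<in> U \<longleftrightarrow> B \<in> U" if "U \<in> H" for U
      proof -
        have "U \<in> p1 \<Longrightarrow> U \<in> c"
          using 1(2) that by blast
        then show ?thesis using B[of U] that by (auto simp: c_def)
      qed
      ultimately show "\<exists>B\<in>V. \<forall>U\<in>H. A \<in> U \<longleftrightarrow> B \<in> U" by blast
    qed
    show "W' \<inter> {A. \<forall>H. finite H \<and> H \<subseteq> D \<longrightarrow> (\<exists>B\<in>V. \<forall>U\<in>H. A \<in> U \<longleftrightarrow> B \<in> U)} = {}"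
    proof (rule equals0I, elim IntE CollectE)
      fix A assume A: "A \<in> W'"
        and R: "\<forall>H. finite H \<and> H \<subseteq> D \<longrightarrow> (\<exists>B\<in>V. \<forall>U\<in>H. A \<in> U \<longleftrightarrow> B \<in> U)"
      obtain H1 where H1: "finite H1" "H1 \<subseteq> Collect ultrafilter_on_nat"
          "\<And>B. (\<forall>U\<in>H1. A \<in> U \<longleftrightarrow> B \<in> U) \<Longrightarrow> B \<in> W'"
        using W' A unfolding pointwise_open_def by meson
      \<comment> \<open>\<open>D\<close> contains the domains of all conditions in \<open>M\<close>,
        so agreement on \<open>H1 \<inter> D\<close> is all that compatibility with such a condition
        requires. The common extension \<open>C\<close> then lies in both \<open>W\<close> and
        \<open>W'\<close>.\<close>
      obtain B where B: "B \<in> V" "\<forall>U\<in>H1 \<inter> D. A \<in> U \<longleftrightarrow> B \<in> U"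
        using R[rule_format, of "H1 \<inter> D"] H1(1) by auto
      obtain H p where Hp: "(H, p) \<in> M" "B \<in> basic H p"
        using B(1) unfolding V_def by blast
      obtain C where C: "\<And>U. U \<in> H \<union> H1 \<Longrightarrow> C \<in> U \<longleftrightarrow> U \<in> p \<union> {U \<in> H1. A \<in> U}"
        by (rule ultrafilter_on_interpolate[of "H \<union> H1" "p \<union> {U \<in> H1. A \<in> U}"]) (use H1 cM[OF Hp(1)] in auto)
      have trace: "A \<in> U \<longleftrightarrow> U \<in> p" if "U \<in> H" "U \<in> H1" for U
        using B(2) Hp(2) fst_D[OF Hp(1)] that unfolding basic_def by blast
      have "C \<in> U \<longleftrightarrow> U \<in> p" if "U \<in> H" for U
        using C[of U] trace[of U] that by blast
      then have "C \<in> basic H p"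
        unfolding basic_def by simp
      moreover have "A \<in> U \<longleftrightarrow> C \<in> U" if "U \<in> H1" for U
        using C[of U] trace[of U] cM(3)[OF Hp(1)] that by blast
      then have "C \<in> W'"
        using H1(3) by simp
      ultimately show False using cM(4)[OF Hp(1)] disj by blast
    qed
  qed
qed

section \<open>Baire sets of the pointwise topology\<close>

text \<open>Taking \<open>E\<close> in every listed ultrafilter freezes the nonprincipal
  coordinates; principal ones remain as conditions on single bits of \<open>X\<close>. Asking for
  all such \<open>E\<close> lets countably many families be merged and leaves \<open>E\<close> to be
  chosen at the end.\<close>

definition trace_baire :: "nat set set \<Rightarrow> bool" where
  "trace_baire S \<longleftrightarrow> (\<exists>\<U>. countable \<U> \<and> (\<forall>U\<in>\<U>. ultrafilter_on_nat U \<and> (\<forall>i. {i} \<notin> U)) \<and>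
     (\<forall>E. (\<forall>U\<in>\<U>. E \<in> U) \<longrightarrow> baire_property {X. E \<union> X \<in> S}))"

lemma trace_baire_sigma_algebra: "sigma_algebra UNIV {S. trace_baire S}"
proof -
  have Compl: "trace_baire (- S)" if "trace_baire S" for S
  proof -
    have "baire_property {X. E \<union> X \<in> - S}" if "baire_property {X. E \<union> X \<in> S}" for E
      using baire_property_Compl[OF that] by (simp add: Collect_neg_eq)
    with that show ?thesis unfolding trace_baire_def by meson
  qed
  have UN: "trace_baire (\<Union>i. S i)" if "\<And>i. trace_baire (S i)" for S :: "nat \<Rightarrow> nat set set"
  proof -
    define R where "R i \<U> \<longleftrightarrow> countable \<U> \<and> (\<forall>U\<in>\<U>. ultrafilter_on_nat U \<and> (\<forall>j. {j} \<notin> U)) \<and>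
        (\<forall>E. (\<forall>U\<in>\<U>. E \<in> U) \<longrightarrow> baire_property {X. E \<union> X \<in> S i})" for i \<U>
    have "\<forall>i. \<exists>\<U>. R i \<U>"
      using that unfolding trace_baire_def R_def by (rule allI)
    then obtain \<U> where R: "\<And>i. R i (\<U> i)"
      by metis
    have \<U>: "countable (\<U> i)" "\<forall>U\<in>\<U> i. ultrafilter_on_nat U \<and> (\<forall>j. {j} \<notin> U)"
        "(\<forall>U\<in>\<U> i. E \<in> U) \<Longrightarrow> baire_property {X. E \<union> X \<in> S i}" for i E
      using R[of i] unfolding R_def by simp_all
    show ?thesis
      unfolding trace_baire_def
    proof (intro exI[of _ "\<Union>i. \<U> i"] conjI allI impI)
      show "countable (\<Union>i. \<U> i)" using \<U>(1) by simp
      show "\<forall>U\<in>(\<Union>i. \<U> i). ultrafilter_on_nat U \<and> (\<forall>j. {j} \<notin> U)" using \<U>(2) by simp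
      fix E assume "\<forall>U\<in>(\<Union>i. \<U> i). E \<in> U"
      then have "baire_property {X. E \<union> X \<in> S i}" for i
        by (intro \<U>(3)) simp
      then have "baire_property (\<Union>i. {X. E \<union> X \<in> S i})"
        by (rule baire_property_UN)
      moreover have "(\<Union>i. {X. E \<union> X \<in> S i}) = {X. E \<union> X \<in> (\<Union>i. S i)}" by blast
      ultimately show "baire_property {X. E \<union> X \<in> (\<Union>i. S i)}" by simp
    qed
  qed
  have empty: "trace_baire {}"
    unfolding trace_baire_def using baire_property_const[of False]
    by (intro exI[of _ "{}"]) simp
  show ?thesis
    unfolding sigma_algebra_iff2
  proof (intro conjI allI ballI impI)
    show "UNIV - S \<in> {S. trace_baire S}" if "S \<in> {S. trace_baire S}" for S
      using Compl that by (simp add: Compl_eq_Diff_UNIV)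
    show "(\<Union>i. S i) \<in> {S. trace_baire S}" if "range S \<subseteq> {S. trace_baire S}" for S :: "nat \<Rightarrow> nat set set"
      using UN that by blast
  qed (simp_all add: empty)
qed

text \<open>For a principal ultrafilter the condition is constant or the single bit
  \<open>i \<in> X\<close>. A nonprincipal \<open>U\<close> is listed itself, and
  \<open>E \<in> U\<close> makes \<open>E \<union> X \<in> U\<close> true for every
  \<open>X\<close>.\<close>

lemma trace_baire_ultrafilter:
  assumes "ultrafilter_on_nat U"
  shows "trace_baire {A. A \<in> U}"
proof (cases "\<exists>i. {i} \<in> U")
  case True
  then obtain i where "U = {A. i \<in> A}"
    using ultrafilter_on_principal_eq[OF assms] by blast
  then have "{X. E \<union> X \<in> U} = (if i \<in> E then {X. True} else {X. i \<in> X})" for E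
    by auto
  then have "baire_property {X. E \<union> X \<in> U}" for E
    using baire_property_const[of True] baire_property_mem[of i] by presburger
  then show ?thesis
    unfolding trace_baire_def by (intro exI[of _ "{}"]) simp
next
  case False
  have "baire_property {X. E \<union> X \<in> U}" if "E \<in> U" for E
    using that ultrafilter_onD(6)[OF assms] baire_property_const[of True] by simp
  then show ?thesis
    unfolding trace_baire_def using assms False by (intro exI[of _ "{U}"]) simp
qed

text \<open>However large \<open>V\<close> is, its members leave only finitely many traces on
  \<open>H\<close>, so the set is a finite union of finite intersections of coordinate conditions
  and their complements.\<close>

lemma trace_baire_finite_pattern:
  assumes "finite H" "H \<subseteq> Collect ultrafilter_on_nat"
  shows "trace_baire {A. \<exists>B\<in>V. \<forall>U\<in>H. A \<in> U \<longleftrightarrow> B \<in> U}"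
proof -
  interpret sigma_algebra UNIV "{S. trace_baire S}" by (rule trace_baire_sigma_algebra)
  have "{A. \<forall>U\<in>H. A \<in> U \<longleftrightarrow> U \<in> p} \<in> {S. trace_baire S}" for p
  proof -
    have "{A. A \<in> U \<longleftrightarrow> U \<in> p} \<in> {S. trace_baire S}" if "U \<in> H" for U
    proof -
      have "{A. A \<in> U} \<in> {S. trace_baire S}"
        using trace_baire_ultrafilter assms(2) that by blast
      moreover from this have "UNIV - {A. A \<in> U} \<in> {S. trace_baire S}"
        by (rule compl_sets)
      moreover have "{A. A \<in> U \<longleftrightarrow> U \<in> p} = (if U \<in> p then {A. A \<in> U} else UNIV - {A. A \<in> U})"
        by auto
      ultimately show ?thesis by presburger
    qed
    then show ?thesis
      using sets_Collect_finite_All[of H "\<lambda>U A. A \<in> U \<longleftrightarrow> U \<in> p"] assms(1) by simp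
  qed
  then have "(\<Union>p\<in>(\<lambda>B. {U \<in> H. B \<in> U}) ` V. {A. \<forall>U\<in>H. A \<in> U \<longleftrightarrow> U \<in> p}) \<in> {S. trace_baire S}"
    using assms(1) by (intro finite_UN) (auto intro: finite_subset[of _ "Pow H"])
  moreover have "(\<Union>p\<in>(\<lambda>B. {U \<in> H. B \<in> U}) ` V. {A. \<forall>U\<in>H. A \<in> U \<longleftrightarrow> U \<in> p})
      = {A. \<exists>B\<in>V. \<forall>U\<in>H. A \<in> U \<longleftrightarrow> B \<in> U}"
    by auto
  ultimately show ?thesis by simp
qed

text \<open>\<open>D\<close> has countably many finite subsets, so the closure that separates
  \<open>W\<close> from \<open>W'\<close> is a countable intersection of finite patterns.\<close>

lemma trace_baire_separation:
  assumes "pointwise_open W" "pointwise_open W'" "W \<inter> W' = {}"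
  obtains R where "trace_baire R" "W \<subseteq> R" "R \<inter> W' = {}"
proof -
  interpret sigma_algebra UNIV "{S. trace_baire S}" by (rule trace_baire_sigma_algebra)
  obtain D V where D: "countable D" "D \<subseteq> Collect ultrafilter_on_nat"
    "W \<subseteq> {A. \<forall>H. finite H \<and> H \<subseteq> D \<longrightarrow> (\<exists>B\<in>V. \<forall>U\<in>H. A \<in> U \<longleftrightarrow> B \<in> U)}"
    "W' \<inter> {A. \<forall>H. finite H \<and> H \<subseteq> D \<longrightarrow> (\<exists>B\<in>V. \<forall>U\<in>H. A \<in> U \<longleftrightarrow> B \<in> U)} = {}"
    by (rule pointwise_open_separation[OF assms])
  have "(\<Inter>H\<in>{H. finite H \<and> H \<subseteq> D}. {A. \<exists>B\<in>V. \<forall>U\<in>H. A \<in> U \<longleftrightarrow> B \<in> U}) \<in> {S. trace_baire S}"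
  proof (rule countable_INT'')
    show "UNIV \<in> {S. trace_baire S}" by (rule top)
    show "countable {H. finite H \<and> H \<subseteq> D}" by (rule countable_Collect_finite_subset[OF D(1)])
    show "{A. \<exists>B\<in>V. \<forall>U\<in>H. A \<in> U \<longleftrightarrow> B \<in> U} \<in> {S. trace_baire S}" if "H \<in> {H. finite H \<and> H \<subseteq> D}" for H
      using trace_baire_finite_pattern[of H] that D(2) by blast
  qed
  moreover have "(\<Inter>H\<in>{H. finite H \<and> H \<subseteq> D}. {A. \<exists>B\<in>V. \<forall>U\<in>H. A \<in> U \<longleftrightarrow> B \<in> U})
     = {A. \<forall>H. finite H \<and> H \<subseteq> D \<longrightarrow> (\<exists>B\<in>V. \<forall>U\<in>H. A \<in> U \<longleftrightarrow> B \<in> U)}"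
    by auto
  ultimately show thesis
    using that D(3,4) by (metis (lifting) inf_commute mem_Collect_eq)
qed

section \<open>Characteristic functions and the Baire sets of C_p\<close>

definition beta_chi :: "nat set \<Rightarrow> nat set set \<Rightarrow> real" where
  "beta_chi A p = (if ultrafilter_on_nat p \<and> A \<in> p then 1 else 0)"

lemma topspace_beta_omega [simp]: "topspace beta_omega = Collect ultrafilter_on_nat"
  unfolding beta_omega_def using ultrafilter_onD(1) by auto

lemma topspace_Cp [simp]: "topspace (Cp K) = Cfun K"
  unfolding Cp_def by auto

lemma topspace_Cw [simp]: "topspace (Cw K) = Cfun K"
  unfolding Cw_def by auto

lemma openin_beta_omega_basic: "openin beta_omega {p. ultrafilter_on_nat p \<and> A \<in> p}"
  unfolding beta_omega_def by (rule topology_generated_by_Basis) blast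

text \<open>The generators form a base and not merely a subbase: an ultrafilter contains
  \<open>A \<inter> B\<close> exactly when it contains both sets.\<close>

lemma openin_beta_omegaE:
  assumes "openin beta_omega W" "p \<in> W"
  obtains A where "A \<in> p" "\<forall>q. ultrafilter_on_nat q \<longrightarrow> A \<in> q \<longrightarrow> q \<in> W"
proof -
  have "generate_topology_on {{p. ultrafilter_on_nat p \<and> A \<in> p} | A. True} W"
    using assms(1) unfolding beta_omega_def by (rule openin_topology_generated_by)
  then have "\<forall>p\<in>W. ultrafilter_on_nat p \<and> (\<exists>A\<in>p. \<forall>q. ultrafilter_on_nat q \<longrightarrow> A \<in> q \<longrightarrow> q \<in> W)"
  proof induction
    case (Int a b)
    show ?case
    proof
      fix p assume p: "p \<in> a \<inter> b"
      obtain A where A: "ultrafilter_on_nat p" "A \<in> p" "\<And>q. ultrafilter_on_nat q \<Longrightarrow> A \<in> q \<Longrightarrow> q \<in> a"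
        using Int.IH(1) p by blast
      obtain B where B: "B \<in> p" "\<And>q. ultrafilter_on_nat q \<Longrightarrow> B \<in> q \<Longrightarrow> q \<in> b"
        using Int.IH(2) p by blast
      show "ultrafilter_on_nat p \<and> (\<exists>A\<in>p. \<forall>q. ultrafilter_on_nat q \<longrightarrow> A \<in> q \<longrightarrow> q \<in> a \<inter> b)"
        using A B ultrafilter_onD(4) by (intro conjI bexI[of _ "A \<inter> B"]) auto
    qed
  next
    case (UN \<K>)
    then show ?case by (meson Union_iff)
  qed auto
  then show thesis using assms(2) that by blast
qed

text \<open>The complement of a basic open set is the basic open set of \<open>- A\<close>, so
  preimages are clopen. The value 0 off the ultrafilters is the one that \<open>Cfun\<close>
  demands.\<close>

lemma beta_chi_Cfun: "beta_chi A \<in> Cfun beta_omega"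
proof -
  have "openin beta_omega {p \<in> topspace beta_omega. beta_chi A p \<in> U}" for U
  proof -
    have "{p \<in> topspace beta_omega. beta_chi A p \<in> U} =
        (if 1 \<in> U then {p. ultrafilter_on_nat p \<and> A \<in> p} else {}) \<union>
        (if 0 \<in> U then {p. ultrafilter_on_nat p \<and> - A \<in> p} else {})"
      by (auto simp: beta_chi_def ultrafilter_onD(5))
    then show ?thesis
      using openin_beta_omega_basic by auto
  qed
  then show ?thesis
    unfolding Cfun_def continuous_map_def by (auto simp: beta_chi_def)
qed

lemma pointwise_openD:
  assumes "pointwise_open W" "A \<in> W"
  shows "\<exists>H. finite H \<and> H \<subseteq> Collect ultrafilter_on_nat \<and>
     (\<forall>B. (\<forall>U\<in>H. A \<in> U \<longleftrightarrow> B \<in> U) \<longrightarrow> B \<in> W)"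
  using assms(1) unfolding pointwise_open_def by (rule bspec[OF _ assms(2)])

lemma pointwise_openI:
  assumes "\<And>A. A \<in> W \<Longrightarrow> \<exists>H. finite H \<and> H \<subseteq> Collect ultrafilter_on_nat \<and>
     (\<forall>B. (\<forall>U\<in>H. A \<in> U \<longleftrightarrow> B \<in> U) \<longrightarrow> B \<in> W)"
  shows "pointwise_open W"
  unfolding pointwise_open_def by (rule ballI, rule assms)

lemma pointwise_open_Int:
  assumes "pointwise_open V" "pointwise_open W"
  shows "pointwise_open (V \<inter> W)"
proof (rule pointwise_openI)
  fix A assume "A \<in> V \<inter> W"
  then have A: "A \<in> V" "A \<in> W" by simp_all
  from pointwise_openD[OF assms(1) A(1)] obtain H where H: "finite H" "H \<subseteq> Collect ultrafilter_on_nat"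
      "\<forall>B. (\<forall>U\<in>H. A \<in> U \<longleftrightarrow> B \<in> U) \<longrightarrow> B \<in> V"
    by (elim exE conjE)
  from pointwise_openD[OF assms(2) A(2)] obtain H' where H': "finite H'" "H' \<subseteq> Collect ultrafilter_on_nat"
      "\<forall>B. (\<forall>U\<in>H'. A \<in> U \<longleftrightarrow> B \<in> U) \<longrightarrow> B \<in> W"
    by (elim exE conjE)
  have "B \<in> V \<inter> W" if "\<forall>U\<in>H \<union> H'. A \<in> U \<longleftrightarrow> B \<in> U" for B
    using H(3)[rule_format, of B] H'(3)[rule_format, of B] that by simp
  then show "\<exists>H. finite H \<and> H \<subseteq> Collect ultrafilter_on_nat \<and>
      (\<forall>B. (\<forall>U\<in>H. A \<in> U \<longleftrightarrow> B \<in> U) \<longrightarrow> B \<in> V \<inter> W)"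
    using H(1,2) H'(1,2) by (intro exI[of _ "H \<union> H'"] conjI allI impI) simp_all
qed

lemma pointwise_open_Union:
  assumes "\<And>W. W \<in> \<W> \<Longrightarrow> pointwise_open W"
  shows "pointwise_open (\<Union>\<W>)"
proof (rule pointwise_openI)
  fix A assume "A \<in> \<Union>\<W>"
  then obtain W where W: "W \<in> \<W>" "A \<in> W" by (rule UnionE)
  from pointwise_openD[OF assms[OF W(1)] W(2)] obtain H where
      H: "finite H" "H \<subseteq> Collect ultrafilter_on_nat"
      "\<forall>B. (\<forall>U\<in>H. A \<in> U \<longleftrightarrow> B \<in> U) \<longrightarrow> B \<in> W"
    by (elim exE conjE)
  show "\<exists>H. finite H \<and> H \<subseteq> Collect ultrafilter_on_nat \<and>
      (\<forall>B. (\<forall>U\<in>H. A \<in> U \<longleftrightarrow> B \<in> U) \<longrightarrow> B \<in> \<Union>\<W>)"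
    using H(1,2) by (intro exI[of _ H] conjI allI impI UnionI[OF W(1)])
      (simp_all add: H(3)[rule_format])
qed

text \<open>This is continuity of \<open>A \<mapsto> beta_chi A\<close>: a subbasic set at
  \<open>x\<close> asks only whether \<open>A \<in> x\<close>, so the one coordinate
  \<open>x\<close> suffices.\<close>

lemma pointwise_open_Cp:
  assumes "openin (Cp beta_omega) W"
  shows "pointwise_open {A. beta_chi A \<in> W}"
proof -
  define G where "G = insert (Cfun beta_omega)
    {{f \<in> Cfun beta_omega. f x \<in> U} | x U. x \<in> topspace beta_omega \<and> open (U :: real set)}"
  have "generate_topology_on G W"
    using assms unfolding Cp_def G_def by (rule openin_topology_generated_by)
  then show ?thesis
  proof induction
    case Empty
    show ?case by (simp add: pointwise_open_def)
  next
    case (Int a b)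
    then show ?case
      using pointwise_open_Int[OF Int.IH] by (simp add: Collect_conj_eq)
  next
    case (UN \<K>)
    have "pointwise_open (\<Union>((\<lambda>k. {A. beta_chi A \<in> k}) ` \<K>))"
      using UN.IH by (intro pointwise_open_Union) (elim imageE, simp)
    moreover have "\<Union>((\<lambda>k. {A. beta_chi A \<in> k}) ` \<K>) = {A. beta_chi A \<in> \<Union>\<K>}"
      by (rule set_eqI) simp
    ultimately show ?case by simp
  next
    case (Basis s)
    then consider "s = Cfun beta_omega"
      | x U where "s = {f \<in> Cfun beta_omega. f x \<in> U}" "ultrafilter_on_nat x"
      unfolding G_def by auto
    then show ?case
    proof cases
      case 1
      then show ?thesis
        using beta_chi_Cfun by (intro pointwise_openI exI[of _ "{}"]) simp
    next
      case 2
      have "beta_chi B \<in> s" if "beta_chi A \<in> s" "\<forall>V\<in>{x}. A \<in> V \<longleftrightarrow> B \<in> V" for A B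
        using that beta_chi_Cfun 2 by (simp add: beta_chi_def)
      then show ?thesis
        using 2(2) by (intro pointwise_openI exI[of _ "{x}"]) simp
    qed
  qed
qed

text \<open>With \<open>h A = g (beta_chi A)\<close>, the sets \<open>h < r\<close> and
  \<open>h > r\<close> are disjoint and pointwise open, so some \<open>trace_baire\<close> set
  contains the first and lies in \<open>h \<le> r\<close>. Letting \<open>r\<close> increase to
  \<open>q\<close> exhausts \<open>h < q\<close>, and half-lines generate the Borel sets.\<close>

lemma trace_baire_continuous:
  assumes g: "continuous_map (Cp beta_omega) euclideanreal g" and U: "open U"
  shows "trace_baire {A. g (beta_chi A) \<in> U}"
proof -
  interpret sigma_algebra UNIV "{S. trace_baire S}" by (rule trace_baire_sigma_algebra)
  define h where "h A = g (beta_chi A)" for A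
  have po: "pointwise_open {A. h A \<in> V}" if "open V" for V
  proof -
    have "openin (Cp beta_omega) {f \<in> topspace (Cp beta_omega). g f \<in> V}"
      using g that unfolding continuous_map_def by simp
    from pointwise_open_Cp[OF this] show ?thesis
      using beta_chi_Cfun by (simp add: h_def)
  qed
  have "trace_baire {A. h A < q}" for q
  proof -
    have "\<exists>R. trace_baire R \<and> {A. h A < q - inverse (Suc n)} \<subseteq> R \<and> R \<inter> {A. q - inverse (Suc n) < h A} = {}" for n
    proof -
      have "pointwise_open {A. h A < q - inverse (Suc n)}" "pointwise_open {A. q - inverse (Suc n) < h A}"
        using po[of "{..<q - inverse (Suc n)}"] po[of "{q - inverse (Suc n)<..}"] by simp_all
      then show ?thesis
        by (rule trace_baire_separation) auto
    qed
    then obtain R where R: "\<And>n. trace_baire (R n)"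
        "\<And>n. {A. h A < q - inverse (Suc n)} \<subseteq> R n"
        "\<And>n. R n \<inter> {A. q - inverse (Suc n) < h A} = {}"
      by metis
    have "(\<Union>n. R n) = {A. h A < q}"
    proof (intro equalityI subsetI)
      fix A assume "A \<in> (\<Union>n. R n)"
      then obtain n where "\<not> q - inverse (Suc n) < h A"
        using R(3) by blast
      moreover have "0 < inverse (real (Suc n))" by simp
      ultimately have "h A < q" by linarith
      then show "A \<in> {A. h A < q}" by simp
    next
      fix A assume "A \<in> {A. h A < q}"
      then obtain n where "inverse (real (Suc n)) < q - h A"
        using reals_Archimedean[of "q - h A"] by auto
      then have "A \<in> {A. h A < q - inverse (Suc n)}" by simp
      then show "A \<in> (\<Union>n. R n)" using R(2)[of n] by blast
    qed
    moreover have "(\<Union>n. R n) \<in> {S. trace_baire S}"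
      using R(1) by (intro countable_nat_UN) auto
    ultimately show ?thesis by simp
  qed
  then have "h \<in> borel_measurable (sigma UNIV {S. trace_baire S})"
    unfolding borel_measurable_iff_less by simp
  then have "h -` U \<inter> space (sigma UNIV {S. trace_baire S}) \<in> sets (sigma UNIV {S. trace_baire S})"
    using borel_open[OF U] by (rule measurable_sets)
  then show ?thesis by (simp add: vimage_def h_def)
qed

lemma trace_baire_baire_sets_Cp:
  assumes "S \<in> baire_sets (Cp beta_omega)"
  shows "trace_baire {A. beta_chi A \<in> S}"
proof -
  interpret sigma_algebra UNIV "{S. trace_baire S}" by (rule trace_baire_sigma_algebra)
  have "{A. beta_chi A \<in> S} \<in> {S. trace_baire S}"
    using assms unfolding baire_sets_def
  proof (induction rule: sigma_sets.induct)
    case (Basic a)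
    then obtain g U where "a = g -` U \<inter> topspace (Cp beta_omega)"
        "continuous_map (Cp beta_omega) euclideanreal g" "open U"
      by blast
    then show ?case
      using trace_baire_continuous[of g U] beta_chi_Cfun by simp
  next
    case (Compl a)
    then have "UNIV - {A. beta_chi A \<in> a} \<in> {S. trace_baire S}"
      by (intro compl_sets)
    moreover have "UNIV - {A. beta_chi A \<in> a} = {A. beta_chi A \<in> topspace (Cp beta_omega) - a}"
      using beta_chi_Cfun by auto
    ultimately show ?case by metis
  next
    case (Union a)
    have "(\<Union>i. {A. beta_chi A \<in> a i}) \<in> {S. trace_baire S}"
      using Union.IH by (intro countable_nat_UN) blast
    moreover have "(\<Union>i. {A. beta_chi A \<in> a i}) = {A. beta_chi A \<in> (\<Union>i. a i)}" by blast
    ultimately show ?case by metis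
  next
    case Empty
    show ?case using empty_sets by simp
  qed
  then show ?thesis by simp
qed

section \<open>Ultralimits\<close>

text \<open>Nonprincipal ultrafilters once more, as filters, so that \<open>Lim\<close> and the
  limit rules apply; \<open>F \<le> sequentially\<close> expresses nonprincipality.\<close>

definition ultra_filter :: "nat filter \<Rightarrow> bool" where
  "ultra_filter F \<longleftrightarrow> F \<noteq> bot \<and> F \<le> sequentially \<and>
     (\<forall>P. eventually P F \<or> eventually (\<lambda>k. \<not> P k) F)"

text \<open>In the compact cube of all maps from predicates to truth values the evaluations
  \<open>a k\<close> have a cluster point \<open>x\<close>. Pulling its neighbourhoods back along
  \<open>a\<close>, together with the tails, gives \<open>F\<close>; the coordinate \<open>P\<close>
  of \<open>x\<close> decides \<open>P\<close>.\<close>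

lemma ultra_filter_exists: "\<exists>F. ultra_filter F"
proof -
  have "compactin (product_topology (\<lambda>_. euclidean) UNIV) (PiE UNIV (\<lambda>_::nat \<Rightarrow> bool. UNIV :: bool set))"
    unfolding compactin_PiE using finite_imp_compact[OF finite] by (auto simp: compactin_euclidean_iff)
  then have "compact (UNIV :: ((nat \<Rightarrow> bool) \<Rightarrow> bool) set)"
    by (simp add: euclidean_product_topology)
  define a where "a k = (\<lambda>P::nat \<Rightarrow> bool. P k)" for k
  have "filtermap a sequentially \<noteq> bot"
    by (simp add: filtermap_bot_iff)
  then obtain x where x: "inf (nhds x) (filtermap a sequentially) \<noteq> bot"
    using \<open>compact UNIV\<close> unfolding compact_filter by auto
  define F where "F = inf (filtercomap a (nhds x)) sequentially"
  have "F \<noteq> bot"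
  proof
    assume "F = bot"
    then have "eventually (\<lambda>_. False) F" by simp
    then obtain Q R where Q: "eventually Q (filtercomap a (nhds x))"
        and R: "eventually R sequentially" and QR: "\<And>k. Q k \<Longrightarrow> R k \<Longrightarrow> False"
      unfolding F_def eventually_inf by blast
    obtain Q' where Q': "eventually Q' (nhds x)" "\<And>k. Q' (a k) \<Longrightarrow> Q k"
      using Q unfolding eventually_filtercomap by blast
    have "eventually (\<lambda>y. \<exists>k. R k \<and> y = a k) (filtermap a sequentially)"
      using R unfolding eventually_filtermap by (rule eventually_mono) blast
    with Q'(1) have "eventually (\<lambda>_. False) (inf (nhds x) (filtermap a sequentially))"
      unfolding eventually_inf using Q'(2) QR by blast
    with x show False by simp
  qed
  moreover have "F \<le> sequentially" unfolding F_def by simp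
  moreover have "eventually P F \<or> eventually (\<lambda>k. \<not> P k) F" for P
  proof -
    have "open {y. y P = x P}"
    proof -
      have "continuous_on UNIV (\<lambda>y::(nat \<Rightarrow> bool) \<Rightarrow> bool. y P)"
        by (rule continuous_on_product_coordinates)
      then have "open ((\<lambda>y::(nat \<Rightarrow> bool) \<Rightarrow> bool. y P) -` {x P})"
        by (rule open_vimage[OF open_discrete])
      then show ?thesis by (simp add: vimage_def)
    qed
    then have "eventually (\<lambda>y. y P = x P) (nhds x)"
      using eventually_nhds_in_open by fastforce
    then have "eventually (\<lambda>k. a k P = x P) (filtercomap a (nhds x))"
      by (rule eventually_filtercomapI)
    then have "eventually (\<lambda>k. P k = x P) F"
      unfolding F_def a_def by (rule filter_leD[OF inf_le1])
    then show ?thesis by (cases "x P") simp_all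
  qed
  ultimately show ?thesis unfolding ultra_filter_def by blast
qed

text \<open>Compactness of \<open>{-c..c}\<close> gives a cluster point of \<open>f\<close> along
  \<open>F\<close>, and along an ultrafilter a cluster point is a limit.\<close>

lemma ultra_filter_bounded_converges:
  fixes f :: "nat \<Rightarrow> real"
  assumes F: "ultra_filter F" and f: "\<And>k. \<bar>f k\<bar> \<le> c"
  shows "(f \<longlongrightarrow> Lim F f) F"
proof -
  have nb: "F \<noteq> bot" using F by (simp add: ultra_filter_def)
  then have "filtermap f F \<noteq> bot" by (simp add: filtermap_bot_iff)
  moreover have "eventually (\<lambda>x. x \<in> {-c..c}) (filtermap f F)"
    unfolding eventually_filtermap using f by (intro always_eventually) (auto simp: abs_le_iff minus_le_iff)
  ultimately obtain l where l: "inf (nhds l) (filtermap f F) \<noteq> bot"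
    using compact_Icc[of "-c" c] unfolding compact_filter by blast
  have "(f \<longlongrightarrow> l) F"
  proof (rule topological_tendstoI)
    fix S assume S: "open S" "l \<in> S"
    show "eventually (\<lambda>k. f k \<in> S) F"
    proof (rule ccontr)
      assume "\<not> ?thesis"
      then have "eventually (\<lambda>k. f k \<notin> S) F"
        using F unfolding ultra_filter_def by blast
      then have "eventually (\<lambda>y. y \<notin> S) (filtermap f F)"
        by (simp add: eventually_filtermap)
      moreover have "eventually (\<lambda>y. y \<in> S) (nhds l)"
        using S by (rule eventually_nhds_in_open)
      ultimately have "eventually (\<lambda>_. False) (inf (nhds l) (filtermap f F))"
        unfolding eventually_inf by blast
      with l show False by simp
    qed
  qed
  with nb show ?thesis by (simp add: tendsto_Lim)
qed

text \<open>The supremum in \<open>supnorm\<close> is not a junk value: an unbounded \<open>f\<close> would be discontinuous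
  at an ultralimit of ultrafilters along which it tends to infinity.\<close>

lemma Cfun_beta_omega_le_supnorm:
  assumes f: "f \<in> Cfun beta_omega" and p: "ultrafilter_on_nat p"
  shows "\<bar>f p\<bar> \<le> supnorm beta_omega f"
proof -
  have "\<exists>c. \<forall>q. ultrafilter_on_nat q \<longrightarrow> \<bar>f q\<bar> \<le> c"
  proof (rule ccontr)
    assume "\<not> ?thesis"
    then have "\<forall>n::nat. \<exists>q. ultrafilter_on_nat q \<and> real n < \<bar>f q\<bar>"
      by (meson not_le)
    then obtain x where x: "\<And>n. ultrafilter_on_nat (x n)" "\<And>n. real n < \<bar>f (x n)\<bar>"
      by metis
    obtain F where F: "ultra_filter F" using ultra_filter_exists by blast
    define q where "q = {A. eventually (\<lambda>n. A \<in> x n) F}"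
    have "ultrafilter_on_nat q"
      unfolding ultrafilter_on_nat_def
    proof (intro conjI allI impI)
      show "UNIV \<in> q" "{} \<notin> q"
        using F ultrafilter_onD(1,2)[OF x(1)] by (auto simp: q_def ultra_filter_def)
      show "B \<in> q" if "A \<in> q \<and> A \<subseteq> B" for A B
        using that ultrafilter_onD(3)[OF x(1)] by (auto simp: q_def elim: eventually_mono)
      show "A \<inter> B \<in> q" if "A \<in> q \<and> B \<in> q" for A B
        using that by (simp add: q_def ultrafilter_onD(4)[OF x(1)] eventually_conj)
      show "A \<in> q \<or> - A \<in> q" for A
        using F by (simp add: q_def ultrafilter_onD(5)[OF x(1)] ultra_filter_def)
    qed
    define W where "W = {p \<in> topspace beta_omega. f p \<in> {f q - 1<..<f q + 1}}"
    have "openin beta_omega W"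
      unfolding W_def by (rule openin_continuous_map_preimage[where Y = euclideanreal]) (use f in \<open>simp_all add: Cfun_def\<close>)
    moreover have "q \<in> W" using \<open>ultrafilter_on_nat q\<close> by (simp add: W_def)
    ultimately obtain A where A: "A \<in> q" "\<forall>p. ultrafilter_on_nat p \<longrightarrow> A \<in> p \<longrightarrow> p \<in> W"
      by (rule openin_beta_omegaE)
    have "eventually (\<lambda>n. x n \<in> W) F"
      using A(1) A(2)[rule_format, OF x(1)] unfolding q_def by (auto elim!: eventually_mono)
    moreover obtain N :: nat where N: "\<bar>f q\<bar> + 1 < real N"
      using reals_Archimedean2 by blast
    have "eventually (\<lambda>n. N \<le> n) F"
      using F eventually_ge_at_top filter_leD unfolding ultra_filter_def by blast
    ultimately have "eventually (\<lambda>_. False) F"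
    proof eventually_elim
      case (elim n)
      then show ?case using x(2)[of n] N by (auto simp: W_def)
    qed
    then show False using F by (simp add: ultra_filter_def)
  qed
  then have "bdd_above ((\<lambda>q. \<bar>f q\<bar>) ` topspace beta_omega)"
    by (auto simp: bdd_above_def)
  then show ?thesis
    unfolding supnorm_def using p by (intro cSUP_upper) simp_all
qed

section \<open>Block densities\<close>

text \<open>Lists of different lengths are distinct, so under \<open>to_nat\<close> the blocks
  become disjoint finite sets of naturals.\<close>

definition block :: "nat \<Rightarrow> nat list set" where
  "block k = {l. length l = k \<and> (\<forall>n<k. l ! n < (n + 2)\<^sup>2)}"

definition block_mean :: "(nat \<Rightarrow> real) \<Rightarrow> nat \<Rightarrow> real" where
  "block_mean f k = (\<Sum>l\<in>block k. f (to_nat l)) / real (card (block k))"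

text \<open>As a complement the set also contains every number that codes no block element; an
  ultrafilter concentrated on those numbers would otherwise escape.\<close>

definition hitting_set :: "(nat \<Rightarrow> nat) \<Rightarrow> nat set" where
  "hitting_set f = - to_nat ` (\<Union>k. {l \<in> block k. \<forall>n<k. l ! n \<noteq> f n})"

lemma finite_card_lists_nth:
  fixes S :: "nat \<Rightarrow> nat set"
  assumes "\<And>n. finite (S n)"
  shows "finite {l. length l = k \<and> (\<forall>n<k. l ! n \<in> S n)} \<and>
    card {l. length l = k \<and> (\<forall>n<k. l ! n \<in> S n)} = (\<Prod>n<k. card (S n))"
proof (induction k)
  case 0
  have "{l::nat list. length l = 0 \<and> (\<forall>n<0. l ! n \<in> S n)} = {[]}" by auto
  then show ?case by simp
next
  case (Suc k)
  let ?L = "\<lambda>k. {l. length l = k \<and> (\<forall>n<k. l ! n \<in> S n)}"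
  have "?L (Suc k) = (\<lambda>(l, a). l @ [a]) ` (?L k \<times> S k)"
  proof (intro equalityI subsetI)
    fix l assume l: "l \<in> ?L (Suc k)"
    then have "l \<noteq> []" by auto
    then have eq: "l = butlast l @ [l ! k]"
      using l by (metis (mono_tags, lifting) append_butlast_last_id diff_Suc_1 last_conv_nth mem_Collect_eq)
    have "butlast l \<in> ?L k" using l by (auto simp: nth_butlast)
    moreover have "l ! k \<in> S k" using l by simp
    ultimately show "l \<in> (\<lambda>(l, a). l @ [a]) ` (?L k \<times> S k)"
      by (intro image_eqI[of _ _ "(butlast l, l ! k)"]) (use eq in simp_all)
  next
    fix l assume "l \<in> (\<lambda>(l, a). l @ [a]) ` (?L k \<times> S k)"
    then show "l \<in> ?L (Suc k)"
      by (auto simp: nth_append less_Suc_eq)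
  qed
  moreover have "inj_on (\<lambda>(l, a). l @ [a]) (?L k \<times> S k)"
    by (auto simp: inj_on_def)
  ultimately show ?case
    using Suc.IH assms[of k] by (simp add: card_image card_cartesian_product)
qed

lemma card_block: "finite (block k)" "card (block k) = (\<Prod>n<k. (n + 2)\<^sup>2)"
  using finite_card_lists_nth[of "\<lambda>n. {..<(n + 2)\<^sup>2}" k] by (simp_all add: block_def)

lemma card_block_pos: "0 < card (block k)"
  unfolding card_block(2) by (rule prod_pos) simp

lemma block_mean_const: "block_mean (\<lambda>_. c) k = c"
  using card_block_pos[of k] by (simp add: block_mean_def)

lemma block_mean_add: "block_mean (\<lambda>j. f j + g j) k = block_mean f k + block_mean g k"
  by (simp add: block_mean_def sum.distrib add_divide_distrib)

lemma block_mean_cmult: "block_mean (\<lambda>j. c * f j) k = c * block_mean f k"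
  by (simp add: block_mean_def flip: sum_distrib_left)

lemma block_mean_mono:
  assumes "\<And>l. l \<in> block k \<Longrightarrow> f (to_nat l) \<le> g (to_nat l)"
  shows "block_mean f k \<le> block_mean g k"
  unfolding block_mean_def by (intro divide_right_mono sum_mono assms) simp_all

lemma abs_block_mean_le:
  assumes "\<And>j. \<bar>f j\<bar> \<le> c"
  shows "\<bar>block_mean f k\<bar> \<le> c"
proof -
  have "f j \<le> c" "- c \<le> f j" for j using assms[of j] by linarith+
  then have "block_mean f k \<le> block_mean (\<lambda>_. c) k" "block_mean (\<lambda>_. - c) k \<le> block_mean f k"
    by (intro block_mean_mono; simp)+
  then show ?thesis by (simp add: block_mean_const)
qed

text \<open>A number codes at most one list and so meets at most one block. Hence changing a set at
  finitely many places does not affect limits of block means.\<close>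

lemma eventually_block_avoids:
  assumes "finite G"
  shows "eventually (\<lambda>k. \<forall>l\<in>block k. to_nat l \<notin> G) sequentially"
proof -
  obtain N where N: "\<And>j. j \<in> G \<Longrightarrow> length (from_nat j :: nat list) < N"
    using assms finite_nat_set_iff_bounded[of "(\<lambda>j. length (from_nat j :: nat list)) ` G"] by (auto simp: image_iff)
  have "\<forall>l\<in>block k. to_nat l \<notin> G" if "N \<le> k" for k
  proof (intro ballI notI)
    fix l assume "l \<in> block k" "to_nat l \<in> G"
    then show False using N[of "to_nat l"] that by (simp add: block_def)
  qed
  then show ?thesis unfolding eventually_sequentially by blast
qed

text \<open>The telescoping choice \<open>c n = (n + 2)\<^sup>2\<close> of the block sides makes the product of
  \<open>1 - 1 / c n\<close> converge to 1/2.\<close>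

lemma prod_block_ratio:
  "(\<Prod>n<k. real ((n + 2)\<^sup>2 - 1)) / (\<Prod>n<k. real ((n + 2)\<^sup>2)) = (real k + 2) / (2 * (real k + 1))"
proof (induction k)
  case (Suc k)
  have "real ((k + 2)\<^sup>2 - 1) = (real k + 1) * (real k + 3)"
    by (simp add: of_nat_diff power2_eq_square algebra_simps)
  moreover have "real ((k + 2)\<^sup>2) = (real k + 2)\<^sup>2" by simp
  ultimately have "(\<Prod>n<Suc k. real ((n + 2)\<^sup>2 - 1)) / (\<Prod>n<Suc k. real ((n + 2)\<^sup>2)) =
      (real k + 2) / (2 * (real k + 1)) * ((real k + 1) * (real k + 3) / (real k + 2)\<^sup>2)"
    unfolding Suc.IH[symmetric] by simp
  also have "\<dots> = (real (Suc k) + 2) / (2 * (real (Suc k) + 1))"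
    by (simp add: divide_simps power2_eq_square) (simp add: algebra_simps)
  finally show ?case .
qed simp

text \<open>The numbers missed in block \<open>k\<close> code a product of the sides with one value
  removed from each, so the proportion missed is the product of the factors
  \<open>1 - 1 / (n + 2)\<^sup>2\<close>.\<close>

lemma block_mean_hitting_set:
  assumes f: "\<And>n. f n < (n + 2)\<^sup>2"
  shows "block_mean (indicator (hitting_set f)) k = 1 - (real k + 2) / (2 * (real k + 1))"
proof -
  define M where "M = {l. length l = k \<and> (\<forall>n<k. l ! n \<in> {..<(n + 2)\<^sup>2} - {f n})}"
  have M: "M \<subseteq> block k" unfolding M_def block_def by auto
  have "card ({..<(n + 2)\<^sup>2} - {f n}) = (n + 2)\<^sup>2 - 1" for n
    using f[of n] by simp
  then have card_M: "card M = (\<Prod>n<k. (n + 2)\<^sup>2 - 1)"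
    unfolding M_def using finite_card_lists_nth[of "\<lambda>n. {..<(n + 2)\<^sup>2} - {f n}" k] by simp
  have ind: "indicator (hitting_set f) (to_nat l) = (1 - indicator M l :: real)" if "l \<in> block k" for l
  proof -
    have "to_nat l \<in> hitting_set f \<longleftrightarrow> (\<exists>n<k. l ! n = f n)"
      using that by (auto simp: hitting_set_def block_def inj_image_mem_iff)
    moreover have "l \<in> M \<longleftrightarrow> \<not> (\<exists>n<k. l ! n = f n)"
      using that by (auto simp: M_def block_def)
    ultimately show ?thesis by (simp add: indicator_def)
  qed
  have "(\<Sum>l\<in>block k. indicator (hitting_set f) (to_nat l)) = (\<Sum>l\<in>block k. 1 - indicator M l :: real)"
    by (rule sum.cong[OF refl ind])
  also have "\<dots> = real (card (block k)) - real (card M)"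
  proof -
    have "(\<Sum>l\<in>block k. indicator M l) = real (card (block k \<inter> M))"
      using card_block(1)[of k] by (simp add: indicator_def of_bool_def sum.If_cases)
    then show ?thesis using M by (simp add: sum_subtractf Int_absorb1)
  qed
  finally have "block_mean (indicator (hitting_set f)) k = 1 - real (card M) / real (card (block k))"
    using card_block_pos[of k] by (simp add: block_mean_def diff_divide_distrib)
  also have "real (card M) / real (card (block k)) = (real k + 2) / (2 * (real k + 1))"
    unfolding card_M card_block(2) using prod_block_ratio[of k] by simp
  finally show ?thesis .
qed

lemma block_mean_hitting_set_tendsto:
  assumes "\<And>n. f n < (n + 2)\<^sup>2"
  shows "(block_mean (indicator (hitting_set f)) \<longlongrightarrow> 1 / 2) sequentially"
proof -
  have eq: "(real k + 2) / (2 * (real k + 1)) = 1 / 2 + 1 / 2 * inverse (real (Suc k))" for k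
    by (simp add: field_simps)
  have "(\<lambda>k. 1 - (1 / 2 + 1 / 2 * inverse (real (Suc k)))) \<longlonglongrightarrow> 1 - (1 / 2 + 1 / 2 * 0)"
    by (intro tendsto_intros LIMSEQ_inverse_real_of_nat)
  moreover have "block_mean (indicator (hitting_set f)) =
      (\<lambda>k. 1 - (1 / 2 + 1 / 2 * inverse (real (Suc k))))"
    by (rule ext) (simp only: block_mean_hitting_set[OF assms] eq)
  ultimately have "block_mean (indicator (hitting_set f)) \<longlonglongrightarrow> 1 - (1 / 2 + 1 / 2 * 0)"
    by simp
  then show ?thesis by simp
qed

text \<open>Codes of block lists of length at most \<open>n\<close> form a finite set, so
  \<open>U\<close> contains either the numbers outside all blocks or one of the finitely many
  classes with a fixed entry \<open>v\<close> at place \<open>n\<close>. Only the value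
  \<open>f n\<close> is constrained, so one \<open>f\<close> can serve countably many ultrafilters,
  a coordinate each.\<close>

lemma hitting_set_in_ultrafilter:
  assumes U: "ultrafilter_on_nat U" "\<And>i. {i} \<notin> U"
  shows "\<exists>v<(n + 2)\<^sup>2. \<forall>f. f n = v \<longrightarrow> hitting_set f \<in> U"
proof -
  define junk where "junk = - to_nat ` (\<Union>k. block k)"
  define short where "short = to_nat ` (\<Union>k\<le>n. block k)"
  define Q where "Q v = to_nat ` (\<Union>k\<in>{n<..}. {l \<in> block k. l ! n = v})" for v :: nat
  have sub: "junk \<union> Q v \<subseteq> hitting_set f" if "f n = v" for f v
    using that by (auto simp: junk_def Q_def hitting_set_def block_def)
  have "finite short"
    unfolding short_def by (simp add: card_block(1))
  then have "short \<notin> U"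
    by (rule ultrafilter_on_finite[OF U])
  moreover have "j \<in> (junk \<union> short) \<union> (\<Union>v\<in>{..<(n + 2)\<^sup>2}. Q v)" for j
  proof (cases "j \<in> junk")
    case False
    then obtain k l where l: "j = to_nat l" "l \<in> block k"
      unfolding junk_def by blast
    show ?thesis
    proof (cases "k \<le> n")
      case True
      then have "j \<in> short" unfolding short_def l(1) using l(2) by blast
      then show ?thesis by simp
    next
      case False
      then have "l ! n < (n + 2)\<^sup>2" using l(2) by (simp add: block_def)
      moreover have "j \<in> Q (l ! n)" using l(2) False unfolding Q_def l(1) by (intro imageI UN_I[of k]) simp_all
      ultimately show ?thesis by blast
    qed
  qed simp
  then have "(junk \<union> short) \<union> (\<Union>v\<in>{..<(n + 2)\<^sup>2}. Q v) = UNIV"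
    by blast
  then have "(junk \<union> short) \<union> (\<Union>v\<in>{..<(n + 2)\<^sup>2}. Q v) \<in> U"
    using ultrafilter_onD(1)[OF U(1)] by (simp only:)
  ultimately have "junk \<in> U \<or> (\<exists>v<(n + 2)\<^sup>2. Q v \<in> U)"
    using ultrafilter_onD(6)[OF U(1)]
      ultrafilter_on_UN[OF U(1) finite_lessThan, of Q "(n + 2)\<^sup>2"] by auto
  \<comment> \<open>If \<open>junk \<in> U\<close>, any \<open>v\<close> serves, and 0 is an
    admissible one.\<close>
  moreover have "0 < (n + 2)\<^sup>2" by simp
  ultimately obtain v where "v < (n + 2)\<^sup>2" "junk \<union> Q v \<in> U"
    using ultrafilter_onD(6)[OF U(1)] by metis
  then show ?thesis
    using ultrafilter_onD(3)[OF U(1)] sub by metis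
qed

section \<open>The functional: an ultralimit of block means over the principal ultrafilters\<close>

definition block_limit :: "nat filter \<Rightarrow> (nat set set \<Rightarrow> real) \<Rightarrow> real" where
  "block_limit F f = Lim F (block_mean (\<lambda>j. f {A. j \<in> A}))"

lemma block_limit_tendsto:
  assumes "ultra_filter F" "f \<in> Cfun beta_omega"
  shows "(block_mean (\<lambda>j. f {A. j \<in> A}) \<longlongrightarrow> block_limit F f) F"
  unfolding block_limit_def
  by (rule ultra_filter_bounded_converges[OF assms(1)], rule abs_block_mean_le,
      rule Cfun_beta_omega_le_supnorm[OF assms(2) ultrafilter_on_principal])

lemma Cfun_add:
  "f \<in> Cfun K \<Longrightarrow> g \<in> Cfun K \<Longrightarrow> (\<lambda>x. f x + g x) \<in> Cfun K"
  by (auto simp: Cfun_def intro: continuous_map_add)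

lemma Cfun_cmult:
  "f \<in> Cfun K \<Longrightarrow> (\<lambda>x. c * f x) \<in> Cfun K"
  by (auto simp: Cfun_def intro: continuous_map_real_mult_left)

lemma block_limit_dual:
  assumes F: "ultra_filter F"
  shows "block_limit F \<in> dual_C beta_omega"
proof -
  have nb: "F \<noteq> bot" using F by (simp add: ultra_filter_def)
  have "block_limit F (\<lambda>x. f x + g x) = block_limit F f + block_limit F g"
    if "f \<in> Cfun beta_omega" "g \<in> Cfun beta_omega" for f g
  proof (rule tendsto_unique[OF nb])
    show "(block_mean (\<lambda>j. f {A. j \<in> A} + g {A. j \<in> A}) \<longlongrightarrow> block_limit F (\<lambda>x. f x + g x)) F"
      by (rule block_limit_tendsto[OF F Cfun_add[OF that]])
    show "(block_mean (\<lambda>j. f {A. j \<in> A} + g {A. j \<in> A}) \<longlongrightarrow> block_limit F f + block_limit F g) F"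
      unfolding block_mean_add by (intro tendsto_add block_limit_tendsto[OF F] that)
  qed
  moreover have "block_limit F (\<lambda>x. c * f x) = c * block_limit F f"
    if "f \<in> Cfun beta_omega" for f c
  proof (rule tendsto_unique[OF nb])
    show "(block_mean (\<lambda>j. c * f {A. j \<in> A}) \<longlongrightarrow> block_limit F (\<lambda>x. c * f x)) F"
      by (rule block_limit_tendsto[OF F Cfun_cmult[OF that]])
    show "(block_mean (\<lambda>j. c * f {A. j \<in> A}) \<longlongrightarrow> c * block_limit F f) F"
      unfolding block_mean_cmult by (intro tendsto_mult_left block_limit_tendsto[OF F] that)
  qed
  moreover have "\<bar>block_limit F f\<bar> \<le> 1 * supnorm beta_omega f" if f: "f \<in> Cfun beta_omega" for f
  proof -
    have "((\<lambda>k. \<bar>block_mean (\<lambda>j. f {A. j \<in> A}) k\<bar>) \<longlongrightarrow> \<bar>block_limit F f\<bar>) F"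
      by (intro tendsto_rabs block_limit_tendsto[OF F f])
    moreover have "\<bar>block_mean (\<lambda>j. f {A. j \<in> A}) k\<bar> \<le> supnorm beta_omega f" for k
      by (rule abs_block_mean_le, rule Cfun_beta_omega_le_supnorm[OF f ultrafilter_on_principal])
    ultimately show ?thesis
      by (simp add: tendsto_upperbound[OF _ always_eventually nb])
  qed
  ultimately show ?thesis
    unfolding dual_C_def by (intro CollectI conjI ballI allI exI[of _ 1]) simp_all
qed

section \<open>A half-space that distinguishes the two Baire algebras\<close>

lemma halfspace_baire_Cw:
  assumes "\<phi> \<in> dual_C K"
  shows "{f \<in> Cfun K. c < \<phi> f} \<in> baire_sets (Cw K)"
proof -
  have "openin (Cw K) {f \<in> Cfun K. \<phi> f \<in> U}" if "open U" for U
    unfolding Cw_def by (rule topology_generated_by_Basis) (use assms that in blast)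
  then have "continuous_map (Cw K) euclideanreal \<phi>"
    by (simp add: continuous_map_def)
  then have "\<phi> -` {c<..} \<inter> topspace (Cw K) \<in> baire_sets (Cw K)"
    unfolding baire_sets_def by (intro sigma_sets.Basic) (use open_greaterThan in blast)
  moreover have "\<phi> -` {c<..} \<inter> topspace (Cw K) = {f \<in> Cfun K. c < \<phi> f}" by auto
  ultimately show ?thesis by simp
qed

text \<open>The threshold 2/3 is tuned to an \<open>E\<close> with \<open>\<mu> E = 1 / 2\<close>.
  For three almost disjoint sets \<open>Z i\<close> the values \<open>\<mu> (E \<union> Z i)\<close>
  sum to at most 2, so not all exceed 2/3; for two sets with cofinite union they sum to at least
  3/2, so not both are at most 2/3. The Baire property would force one of these cases on the generic
  sets of some cylinder.\<close>

lemma block_limit_not_trace_baire: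
  assumes F: "ultra_filter F"
  shows "\<not> trace_baire {A. 2 / 3 < block_limit F (beta_chi A)}"
proof
  assume "trace_baire {A. 2 / 3 < block_limit F (beta_chi A)}"
  then obtain \<U> where \<U>: "countable \<U>"
      "\<forall>U\<in>\<U>. ultrafilter_on_nat U \<and> (\<forall>i. {i} \<notin> U)"
      "\<forall>E. (\<forall>U\<in>\<U>. E \<in> U) \<longrightarrow> baire_property {X. E \<union> X \<in> {A. 2 / 3 < block_limit F (beta_chi A)}}"
    unfolding trace_baire_def by (elim exE conjE)
  have nb: "F \<noteq> bot" and seq: "F \<le> sequentially"
    using F by (simp_all add: ultra_filter_def)
  define \<mu> where "\<mu> A = block_limit F (beta_chi A)" for A
  have \<mu>: "(block_mean (indicator A) \<longlongrightarrow> \<mu> A) F" for A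
  proof -
    have "(\<lambda>j. beta_chi A {B. j \<in> B}) = indicator A"
      by (rule ext) (simp add: beta_chi_def ultrafilter_on_principal indicator_def)
    then show ?thesis
      using block_limit_tendsto[OF F beta_chi_Cfun[of A]] by (simp add: \<mu>_def)
  qed
  \<comment> \<open>Coordinate \<open>n\<close> of \<open>f\<close> is reserved for the ultrafilter
    with index \<open>n\<close>. The guard covers an empty \<open>\<U>\<close>, for which
    \<open>from_nat_into\<close> has no meaningful value.\<close>
  have "\<exists>v<(n + 2)\<^sup>2. from_nat_into \<U> n \<in> \<U> \<longrightarrow> (\<forall>f. f n = v \<longrightarrow> hitting_set f \<in> from_nat_into \<U> n)" for n
  proof (cases "from_nat_into \<U> n \<in> \<U>")
    case True
    then show ?thesis
      using hitting_set_in_ultrafilter[of "from_nat_into \<U> n" n] \<U>(2) by simp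
  next
    case False
    then show ?thesis by (intro exI[of _ 0]) simp
  qed
  then obtain f where f: "\<And>n. f n < (n + 2)\<^sup>2"
      "\<And>n g. from_nat_into \<U> n \<in> \<U> \<Longrightarrow> g n = f n \<Longrightarrow> hitting_set g \<in> from_nat_into \<U> n"
    by metis
  define E where "E = hitting_set f"
  have E: "E \<in> U" if "U \<in> \<U>" for U
  proof -
    from from_nat_into_surj[OF \<U>(1) that] obtain n where "from_nat_into \<U> n = U" ..
    then show ?thesis using f(2)[of n f] that by (simp add: E_def)
  qed
  have E_lim: "(block_mean (indicator E) \<longlongrightarrow> 1 / 2) F"
    unfolding E_def by (rule filterlim_mono[OF block_mean_hitting_set_tendsto[OF f(1)] order_refl seq])
  have "baire_property {X. 2 / 3 < \<mu> (E \<union> X)}"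
    using \<U>(3)[rule_format, of E] E by (simp add: \<mu>_def)
  then obtain \<D> where \<D>: "countable \<D>" "\<forall>D\<in>\<D>. dense_interior D"
      "baire_property_wrt \<D> {X. 2 / 3 < \<mu> (E \<union> X)}"
    unfolding baire_property_def by (elim exE conjE)
  obtain B m where Bm: "(\<forall>X. agree_below m B X \<longrightarrow> X \<in> \<Inter>\<D> \<longrightarrow> X \<in> {X. 2 / 3 < \<mu> (E \<union> X)}) \<or>
       (\<forall>X. agree_below m B X \<longrightarrow> X \<in> \<Inter>\<D> \<longrightarrow> X \<notin> {X. 2 / 3 < \<mu> (E \<union> X)})"
    using \<D>(3)[unfolded baire_property_wrt_def, rule_format, of 0 "{}"] by (elim exE conjE)
  have ev: "eventually (\<lambda>k. \<forall>l\<in>block k. m \<le> to_nat l) F"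
    using filter_leD[OF seq eventually_block_avoids[of "{..<m}"]] by (simp add: not_less)
  from Bm show False
  proof
    assume large: "\<forall>X. agree_below m B X \<longrightarrow> X \<in> \<Inter>\<D> \<longrightarrow> X \<in> {X. 2 / 3 < \<mu> (E \<union> X)}"
    from generic_family[OF \<D>(1,2), of m B "{}"] obtain Z :: "nat \<Rightarrow> nat set" where Z: "\<forall>i. Z i \<in> \<Inter>\<D>"
        "\<forall>i. agree_below m B (Z i)"
        "\<forall>k i j. m \<le> k \<longrightarrow> i \<noteq> j \<longrightarrow> (k \<in> Z i \<longleftrightarrow> k \<in> {}) \<or> (k \<in> Z j \<longleftrightarrow> k \<in> {})"
      by (elim exE conjE)
    have disj: "k \<notin> Z i \<or> k \<notin> Z j" if "m \<le> k" "i \<noteq> j" for i j k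
      using Z(3)[rule_format, OF that] by simp
    \<comment> \<open>From \<open>m\<close> on, all three indicators are 1 on \<open>E\<close> and
      at most one is 1 off \<open>E\<close>, so their sum is at most
      \<open>1 + 2 * indicator E\<close>.\<close>
    have "\<mu> (E \<union> Z 0) + \<mu> (E \<union> Z 1) + \<mu> (E \<union> Z 2) \<le> 1 + 2 * (1 / 2)"
    proof (rule tendsto_le[OF nb])
      show "((\<lambda>k. block_mean (indicator (E \<union> Z 0)) k + block_mean (indicator (E \<union> Z 1)) k
          + block_mean (indicator (E \<union> Z 2)) k) \<longlongrightarrow> \<mu> (E \<union> Z 0) + \<mu> (E \<union> Z 1) + \<mu> (E \<union> Z 2)) F"
        by (intro tendsto_add \<mu>)
      show "((\<lambda>k. 1 + 2 * block_mean (indicator E) k) \<longlongrightarrow> 1 + 2 * (1 / 2)) F"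
        by (intro tendsto_intros E_lim)
      show "eventually (\<lambda>k. block_mean (indicator (E \<union> Z 0)) k + block_mean (indicator (E \<union> Z 1)) k
          + block_mean (indicator (E \<union> Z 2)) k \<le> 1 + 2 * block_mean (indicator E) k) F"
        using ev
      proof (rule eventually_mono)
        fix k assume k: "\<forall>l\<in>block k. m \<le> to_nat l"
        have "block_mean (\<lambda>j. indicator (E \<union> Z 0) j + indicator (E \<union> Z 1) j + indicator (E \<union> Z 2) j) k
            \<le> block_mean (\<lambda>j. 1 + 2 * indicator E j) k"
        proof (rule block_mean_mono)
          fix l assume "l \<in> block k"
          then have "m \<le> to_nat l" using k by blast
          from disj[OF this, of 0 1] disj[OF this, of 0 2] disj[OF this, of 1 2]
          show "indicator (E \<union> Z 0) (to_nat l) + indicator (E \<union> Z 1) (to_nat l)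
              + indicator (E \<union> Z 2) (to_nat l) \<le> (1 + 2 * indicator E (to_nat l) :: real)"
            by (auto simp: indicator_def)
        qed
        then show "block_mean (indicator (E \<union> Z 0)) k + block_mean (indicator (E \<union> Z 1)) k
          + block_mean (indicator (E \<union> Z 2)) k \<le> 1 + 2 * block_mean (indicator E) k"
          by (simp add: block_mean_add block_mean_cmult block_mean_const)
      qed
    qed
    moreover have "2 / 3 < \<mu> (E \<union> Z i)" for i
      using large[rule_format, OF Z(2)[rule_format] Z(1)[rule_format], of i] by simp
    from this[of 0] this[of 1] this[of 2]
    have "2 < \<mu> (E \<union> Z 0) + \<mu> (E \<union> Z 1) + \<mu> (E \<union> Z 2)" by linarith
    ultimately show False by simp
  next
    assume small: "\<forall>X. agree_below m B X \<longrightarrow> X \<in> \<Inter>\<D> \<longrightarrow> X \<notin> {X. 2 / 3 < \<mu> (E \<union> X)}"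
    from generic_family[OF \<D>(1,2), of m B UNIV] obtain Z :: "nat \<Rightarrow> nat set" where Z: "\<forall>i. Z i \<in> \<Inter>\<D>"
        "\<forall>i. agree_below m B (Z i)"
        "\<forall>k i j. m \<le> k \<longrightarrow> i \<noteq> j \<longrightarrow> (k \<in> Z i \<longleftrightarrow> k \<in> UNIV) \<or> (k \<in> Z j \<longleftrightarrow> k \<in> UNIV)"
      by (elim exE conjE)
    have cover: "k \<in> Z 0 \<or> k \<in> Z 1" if "m \<le> k" for k
      using Z(3)[rule_format, OF that, of 0 1] by simp
    \<comment> \<open>From \<open>m\<close> on, both indicators are 1 on \<open>E\<close> and at
      least one is 1 off \<open>E\<close>.\<close>
    have "1 + 1 / 2 \<le> \<mu> (E \<union> Z 0) + \<mu> (E \<union> Z 1)"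
    proof (rule tendsto_le[OF nb])
      show "((\<lambda>k. block_mean (indicator (E \<union> Z 0)) k + block_mean (indicator (E \<union> Z 1)) k)
          \<longlongrightarrow> \<mu> (E \<union> Z 0) + \<mu> (E \<union> Z 1)) F"
        by (intro tendsto_add \<mu>)
      show "((\<lambda>k. 1 + block_mean (indicator E) k) \<longlongrightarrow> 1 + 1 / 2) F"
        by (intro tendsto_intros E_lim)
      show "eventually (\<lambda>k. 1 + block_mean (indicator E) k \<le>
          block_mean (indicator (E \<union> Z 0)) k + block_mean (indicator (E \<union> Z 1)) k) F"
        using ev
      proof (rule eventually_mono)
        fix k assume k: "\<forall>l\<in>block k. m \<le> to_nat l"
        have "block_mean (\<lambda>j. 1 + indicator E j) k \<le>
            block_mean (\<lambda>j. indicator (E \<union> Z 0) j + indicator (E \<union> Z 1) j) k"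
        proof (rule block_mean_mono)
          fix l assume "l \<in> block k"
          then have "m \<le> to_nat l" using k by blast
          from cover[OF this]
          show "(1 + indicator E (to_nat l) :: real) \<le>
              indicator (E \<union> Z 0) (to_nat l) + indicator (E \<union> Z 1) (to_nat l)"
            by (auto simp: indicator_def)
        qed
        then show "1 + block_mean (indicator E) k \<le>
          block_mean (indicator (E \<union> Z 0)) k + block_mean (indicator (E \<union> Z 1)) k"
          by (simp add: block_mean_add block_mean_const)
      qed
    qed
    moreover have "\<mu> (E \<union> Z i) \<le> 2 / 3" for i
      using small[rule_format, OF Z(2)[rule_format] Z(1)[rule_format], of i] by simp
    from this[of 0] this[of 1]
    have "\<mu> (E \<union> Z 0) + \<mu> (E \<union> Z 1) \<le> 4 / 3" by linarith
    ultimately show False by simp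
  qed
qed

theorem theorem3p4:
  shows "baire_sets (Cp beta_omega) \<noteq> baire_sets (Cw beta_omega)"
proof
  assume eq: "baire_sets (Cp beta_omega) = baire_sets (Cw beta_omega)"
  obtain F where F: "ultra_filter F" using ultra_filter_exists by blast
  have "{f \<in> Cfun beta_omega. 2 / 3 < block_limit F f} \<in> baire_sets (Cp beta_omega)"
    unfolding eq by (rule halfspace_baire_Cw[OF block_limit_dual[OF F]])
  from trace_baire_baire_sets_Cp[OF this]
  have "trace_baire {A. 2 / 3 < block_limit F (beta_chi A)}"
    by (simp add: beta_chi_Cfun)
  with block_limit_not_trace_baire[OF F] show False ..
qed

end
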